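(* For every implicative morphism $f:\mathcal A\to\mathcal B$ between binary implicative arrow algebras, let $$f^{\to}:\mathcal A^{\to}\to\mathcal B^{\to},\qquad f^{\to}(x_0,x_1)=\Big(\bigwedge_{x_0\preccurlyeq a}\partial f(a),\ \bigwedge_{x_1\preccurlyeq a}\partial f(a)\Big).$$ Then $(-)^{\to}$, given by $\mathcal A\mapsto\mathcal A^{\to}$ and $f\mapsto f^{\to}$, is a pseudofunctor $\mathsf{ArrAlg}_{\mathsf{bi}}\to\mathsf{ArrAlg}_{\mathsf{bi}}$. Moreover, if $f$ is computationally dense with right adjoint $h:\mathcal B\to\mathcal A$, then $f^{\to}$ is computationally dense as well, and a right adjoint is given by $h^{\to}:\mathcal B^{\to}\to\mathcal A^{\to}$.
   Context: An arrow algebra $\mathcal A=(A,\preccurlyeq,\to,S)$ consists of a poset $(A,\preccurlyeq)$ with all meets (written $\bigwedge$, binary meets $\wedge$; top $\top$); a binary operation $\to$ on $A$ (bracketed to the right, binding tighter than $\wedge$), antitone in the first and monotone in the second argument; and a subset $S\subseteq A$ (the separator) which is upward closed, closed under modus ponens ($a\to b\in S$ and $a\in S$ imply $b\in S$), and contains the combinators $\mathbf k=\bigwedge_{a,b}a\to b\to a$, $\mathbf s=\bigwedge_{a,b,c}(a\to b\to c)\to(a\to b)\to a\to c$, and $\mathbf a=\bigwedge_{a,(b_i)_{i\in I},(c_i)_{i\in I}}\big(\bigwedge_{i\in I}a\to b_i\to c_i\big)\to a\to\bigwedge_{i\in I}(b_i\to c_i)$. Put $\partial a=\top\to a$. An implicative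 morphism $f:\mathcal A\to\mathcal B$ is a function $f:A\to B$ such that: (i) $f(a)\in S_B$ for every $a\in S_A$; (ii) there is $r\in S_B$ with $r\preccurlyeq f(a\to a')\to f(a)\to f(a')$ for all $a,a'\in A$; (iii) for every $X\subseteq A\times A$, if $\bigwedge_{(a,a')\in X}a\to a'\in S_A$ then $\bigwedge_{(a,a')\in X}f(a)\to f(a')\in S_B$. Write $f\vdash f'$ if $\bigwedge_{a\in A}f(a)\to f'(a)\in S_B$. $\mathsf{ArrAlg}$ is the resulting preorder-enriched category. $f:\mathcal A\to\mathcal B$ is computationally dense if it has a right adjoint, i.e. an implicative morphism $h:\mathcal B\to\mathcal A$ with $fh\vdash\mathrm{id}_B$ and $\mathrm{id}_A\vdash hf$. $\mathcal A$ is binary implicative if $a\to(b\wedge c)=(a\to b)\wedge(a\to c)$ for all $a,b,c\in A$; $\mathsf{ArrAlg}_{\mathsf{bi}}$ is the full subcategory of $\mathsf{ArrAlg}$ on these. For $\mathcal A$ binary implicative, the Sierpiński construction is the binary implicative arrow algebra $\mathcal A^{\to}=(A^{\to},\preccurlyeq,\to,S^{\to})$ with $A^{\to}=\{(x_0,x_1)\in A\times A:x_0\preccurlyeq x_1\}$, pointwise order, $x\to y=\big((x_0\to y_0)\wedge(x_1\to y_1),\,x_1\to y_1\big)$, and $S^{\to}=\{x\in A^{\to}:x_0\in S\}$. A pseudofunctor between preorder-enriched categories preserves the order on morphisms, and preserves identities and composition up to isomorphism. *)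

theory Defs
  imports "HOL-Algebra.Complete_Lattice" "HOL-Library.FuncSet"
begin

section \<open>Arrow algebras\<close>

text \<open>Order-theoretic notions (meets, binary meets, top, lower bounds) are those of HOL-Algebra;
  as there, all data are only meaningful on the carrier.\<close>

record 'a arrow_structure = "'a gorder" +
  imp :: "'a \<Rightarrow> 'a \<Rightarrow> 'a" (infixr "\<leadsto>\<index>" 75)
  separator :: "'a set"

definition comb_k :: "'a arrow_structure \<Rightarrow> 'a" where
  "comb_k A = \<Sqinter>\<^bsub>A\<^esub> {a \<leadsto>\<^bsub>A\<^esub> b \<leadsto>\<^bsub>A\<^esub> a | a b. a \<in> carrier A \<and> b \<in> carrier A}"

definition comb_s :: "'a arrow_structure \<Rightarrow> 'a" where
  "comb_s A = \<Sqinter>\<^bsub>A\<^esub> {(a \<leadsto>\<^bsub>A\<^esub> b \<leadsto>\<^bsub>A\<^esub> c) \<leadsto>\<^bsub>A\<^esub> (a \<leadsto>\<^bsub>A\<^esub> b) \<leadsto>\<^bsub>A\<^esub> a \<leadsto>\<^bsub>A\<^esub> c | a b c.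
      a \<in> carrier A \<and> b \<in> carrier A \<and> c \<in> carrier A}"

text \<open>The combinator \<open>\<^bold>a\<close> is a meet over all pairs of equally indexed families
  \<open>(b\<^sub>i)\<close>, \<open>(c\<^sub>i)\<close>. Its entries only depend on the set of pairs \<open>(b\<^sub>i, c\<^sub>i)\<close>,
  and every set of pairs arises, so the families are represented by such sets;
  see \<open>comb_a_entry_family\<close>.\<close>

definition comb_a_entry :: "'a arrow_structure \<Rightarrow> 'a \<Rightarrow> ('a \<times> 'a) set \<Rightarrow> 'a" where
  "comb_a_entry A a Y =
     (\<Sqinter>\<^bsub>A\<^esub> {a \<leadsto>\<^bsub>A\<^esub> b \<leadsto>\<^bsub>A\<^esub> c | b c. (b, c) \<in> Y}) \<leadsto>\<^bsub>A\<^esub> a \<leadsto>\<^bsub>A\<^esub> (\<Sqinter>\<^bsub>A\<^esub> {b \<leadsto>\<^bsub>A\<^esub> c | b c. (b, c) \<in> Y})"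

definition comb_a :: "'a arrow_structure \<Rightarrow> 'a" where
  "comb_a A = \<Sqinter>\<^bsub>A\<^esub> {comb_a_entry A a Y | a Y. a \<in> carrier A \<and> Y \<subseteq> carrier A \<times> carrier A}"

lemma comb_a_entry_family:
  "comb_a_entry A a ((\<lambda>i. (b i, c i)) ` I) =
     (\<Sqinter>\<^bsub>A\<^esub> ((\<lambda>i. a \<leadsto>\<^bsub>A\<^esub> b i \<leadsto>\<^bsub>A\<^esub> c i) ` I)) \<leadsto>\<^bsub>A\<^esub> a \<leadsto>\<^bsub>A\<^esub> (\<Sqinter>\<^bsub>A\<^esub> ((\<lambda>i. b i \<leadsto>\<^bsub>A\<^esub> c i) ` I))"
proof -
  have "{a \<leadsto>\<^bsub>A\<^esub> x \<leadsto>\<^bsub>A\<^esub> y | x y. (x, y) \<in> (\<lambda>i. (b i, c i)) ` I} = (\<lambda>i. a \<leadsto>\<^bsub>A\<^esub> b i \<leadsto>\<^bsub>A\<^esub> c i) ` I"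
    and "{x \<leadsto>\<^bsub>A\<^esub> y | x y. (x, y) \<in> (\<lambda>i. (b i, c i)) ` I} = (\<lambda>i. b i \<leadsto>\<^bsub>A\<^esub> c i) ` I"
    by auto
  then show ?thesis by (simp add: comb_a_entry_def)
qed

locale arrow_algebra = partial_order A for A :: "'a arrow_structure" (structure) +
  assumes meets_exist: "X \<subseteq> carrier A \<Longrightarrow> \<exists>m. greatest A m (Lower A X)"
    and imp_closed: "\<lbrakk>a \<in> carrier A; b \<in> carrier A\<rbrakk> \<Longrightarrow> a \<leadsto> b \<in> carrier A"
    and imp_antitone: "\<lbrakk>a \<in> carrier A; a' \<in> carrier A; b \<in> carrier A; a \<sqsubseteq> a'\<rbrakk> \<Longrightarrow> a' \<leadsto> b \<sqsubseteq> a \<leadsto> b"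
    and imp_monotone: "\<lbrakk>a \<in> carrier A; b \<in> carrier A; b' \<in> carrier A; b \<sqsubseteq> b'\<rbrakk> \<Longrightarrow> a \<leadsto> b \<sqsubseteq> a \<leadsto> b'"
    and separator_subset: "separator A \<subseteq> carrier A"
    and separator_upward: "\<lbrakk>a \<in> separator A; b \<in> carrier A; a \<sqsubseteq> b\<rbrakk> \<Longrightarrow> b \<in> separator A"
    and separator_mp:
      "\<lbrakk>a \<in> carrier A; b \<in> carrier A; a \<leadsto> b \<in> separator A; a \<in> separator A\<rbrakk> \<Longrightarrow> b \<in> separator A"
    and separator_k: "comb_k A \<in> separator A"
    and separator_s: "comb_s A \<in> separator A"
    and separator_a: "comb_a A \<in> separator A"

definition binary_implicative :: "'a arrow_structure \<Rightarrow> bool" where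
  "binary_implicative A \<longleftrightarrow> arrow_algebra A \<and>
     (\<forall>a\<in>carrier A. \<forall>b\<in>carrier A. \<forall>c\<in>carrier A.
        a \<leadsto>\<^bsub>A\<^esub> (b \<sqinter>\<^bsub>A\<^esub> c) = (a \<leadsto>\<^bsub>A\<^esub> b) \<sqinter>\<^bsub>A\<^esub> (a \<leadsto>\<^bsub>A\<^esub> c))"

definition del :: "'a arrow_structure \<Rightarrow> 'a \<Rightarrow> 'a" where
  "del A a = \<top>\<^bsub>A\<^esub> \<leadsto>\<^bsub>A\<^esub> a"


section \<open>Implicative morphisms\<close>

text \<open>Functions between carriers are represented by extensional functions, so that equality
  of morphisms is equality on the carrier.\<close>

definition implicative_morphism ::
    "'a arrow_structure \<Rightarrow> 'b arrow_structure \<Rightarrow> ('a \<Rightarrow> 'b) \<Rightarrow> bool" where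
  "implicative_morphism A B f \<longleftrightarrow>
     f \<in> carrier A \<rightarrow>\<^sub>E carrier B \<and>
     (\<forall>a\<in>separator A. f a \<in> separator B) \<and>
     (\<exists>r\<in>separator B. \<forall>a\<in>carrier A. \<forall>a'\<in>carrier A.
        r \<sqsubseteq>\<^bsub>B\<^esub> f (a \<leadsto>\<^bsub>A\<^esub> a') \<leadsto>\<^bsub>B\<^esub> f a \<leadsto>\<^bsub>B\<^esub> f a') \<and>
     (\<forall>X \<subseteq> carrier A \<times> carrier A.
        \<Sqinter>\<^bsub>A\<^esub> {a \<leadsto>\<^bsub>A\<^esub> a' | a a'. (a, a') \<in> X} \<in> separator A \<longrightarrow>
        \<Sqinter>\<^bsub>B\<^esub> {f a \<leadsto>\<^bsub>B\<^esub> f a' | a a'. (a, a') \<in> X} \<in> separator B)"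

definition morphism_le ::
    "'a arrow_structure \<Rightarrow> 'b arrow_structure \<Rightarrow> ('a \<Rightarrow> 'b) \<Rightarrow> ('a \<Rightarrow> 'b) \<Rightarrow> bool" where
  "morphism_le A B f f' \<longleftrightarrow> \<Sqinter>\<^bsub>B\<^esub> {f a \<leadsto>\<^bsub>B\<^esub> f' a | a. a \<in> carrier A} \<in> separator B"

definition morphism_iso ::
    "'a arrow_structure \<Rightarrow> 'b arrow_structure \<Rightarrow> ('a \<Rightarrow> 'b) \<Rightarrow> ('a \<Rightarrow> 'b) \<Rightarrow> bool" where
  "morphism_iso A B f f' \<longleftrightarrow> morphism_le A B f f' \<and> morphism_le A B f' f"

definition identity_morphism :: "'a arrow_structure \<Rightarrow> 'a \<Rightarrow> 'a" where
  "identity_morphism A = (\<lambda>a\<in>carrier A. a)"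

definition right_adjoint ::
    "'a arrow_structure \<Rightarrow> 'b arrow_structure \<Rightarrow> ('a \<Rightarrow> 'b) \<Rightarrow> ('b \<Rightarrow> 'a) \<Rightarrow> bool" where
  "right_adjoint A B f h \<longleftrightarrow>
     implicative_morphism B A h \<and>
     morphism_le B B (compose (carrier B) f h) (identity_morphism B) \<and>
     morphism_le A A (identity_morphism A) (compose (carrier A) h f)"

definition computationally_dense ::
    "'a arrow_structure \<Rightarrow> 'b arrow_structure \<Rightarrow> ('a \<Rightarrow> 'b) \<Rightarrow> bool" where
  "computationally_dense A B f \<longleftrightarrow> implicative_morphism A B f \<and> (\<exists>h. right_adjoint A B f h)"


section \<open>Preorder-enriched categories and pseudofunctors\<close>

text \<open>\<open>Comp C a b c g f\<close> is the composite of \<open>f\<close> from \<open>a\<close> to \<open>b\<close> with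
  \<open>g\<close> from \<open>b\<close> to \<open>c\<close>.\<close>

record ('o, 'm) enriched_structure =
  Obj :: "'o set"
  Hom :: "'o \<Rightarrow> 'o \<Rightarrow> 'm set"
  Leq :: "'o \<Rightarrow> 'o \<Rightarrow> 'm \<Rightarrow> 'm \<Rightarrow> bool"
  Comp :: "'o \<Rightarrow> 'o \<Rightarrow> 'o \<Rightarrow> 'm \<Rightarrow> 'm \<Rightarrow> 'm"
  Ident :: "'o \<Rightarrow> 'm"

locale preorder_enriched_category =
  fixes C :: "('o, 'm) enriched_structure"
  assumes Ident_in_Hom: "a \<in> Obj C \<Longrightarrow> Ident C a \<in> Hom C a a"
    and Comp_in_Hom:
      "\<lbrakk>a \<in> Obj C; b \<in> Obj C; c \<in> Obj C; f \<in> Hom C a b; g \<in> Hom C b c\<rbrakk>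
        \<Longrightarrow> Comp C a b c g f \<in> Hom C a c"
    and Comp_Ident_left:
      "\<lbrakk>a \<in> Obj C; b \<in> Obj C; f \<in> Hom C a b\<rbrakk> \<Longrightarrow> Comp C a b b (Ident C b) f = f"
    and Comp_Ident_right:
      "\<lbrakk>a \<in> Obj C; b \<in> Obj C; f \<in> Hom C a b\<rbrakk> \<Longrightarrow> Comp C a a b f (Ident C a) = f"
    and Comp_assoc:
      "\<lbrakk>a \<in> Obj C; b \<in> Obj C; c \<in> Obj C; d \<in> Obj C;
        f \<in> Hom C a b; g \<in> Hom C b c; h \<in> Hom C c d\<rbrakk>
        \<Longrightarrow> Comp C a c d h (Comp C a b c g f) = Comp C a b d (Comp C b c d h g) f"
    and Leq_refl: "\<lbrakk>a \<in> Obj C; b \<in> Obj C; f \<in> Hom C a b\<rbrakk> \<Longrightarrow> Leq C a b f f"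
    and Leq_trans:
      "\<lbrakk>a \<in> Obj C; b \<in> Obj C; f \<in> Hom C a b; g \<in> Hom C a b; h \<in> Hom C a b;
        Leq C a b f g; Leq C a b g h\<rbrakk> \<Longrightarrow> Leq C a b f h"
    and Comp_mono:
      "\<lbrakk>a \<in> Obj C; b \<in> Obj C; c \<in> Obj C;
        f \<in> Hom C a b; f' \<in> Hom C a b; g \<in> Hom C b c; g' \<in> Hom C b c;
        Leq C a b f f'; Leq C b c g g'\<rbrakk>
        \<Longrightarrow> Leq C a c (Comp C a b c g f) (Comp C a b c g' f')"

definition Iso2 :: "('o, 'm) enriched_structure \<Rightarrow> 'o \<Rightarrow> 'o \<Rightarrow> 'm \<Rightarrow> 'm \<Rightarrow> bool" where
  "Iso2 C a b f g \<longleftrightarrow> Leq C a b f g \<and> Leq C a b g f"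

text \<open>The coherence conditions on the invertible 2-cells hold trivially, since parallel 2-cells
  in a preorder-enriched category are equal.\<close>

locale pseudofunctor =
  C: preorder_enriched_category C + D: preorder_enriched_category D
  for C :: "('o, 'm) enriched_structure" and D :: "('p, 'n) enriched_structure"
    and F\<^sub>0 :: "'o \<Rightarrow> 'p" and F\<^sub>1 :: "'o \<Rightarrow> 'o \<Rightarrow> 'm \<Rightarrow> 'n" +
  assumes F_Obj: "a \<in> Obj C \<Longrightarrow> F\<^sub>0 a \<in> Obj D"
    and F_Hom:
      "\<lbrakk>a \<in> Obj C; b \<in> Obj C; f \<in> Hom C a b\<rbrakk> \<Longrightarrow> F\<^sub>1 a b f \<in> Hom D (F\<^sub>0 a) (F\<^sub>0 b)"
    and F_Leq:
      "\<lbrakk>a \<in> Obj C; b \<in> Obj C; f \<in> Hom C a b; f' \<in> Hom C a b; Leq C a b f f'\<rbrakk>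
        \<Longrightarrow> Leq D (F\<^sub>0 a) (F\<^sub>0 b) (F\<^sub>1 a b f) (F\<^sub>1 a b f')"
    and F_Ident:
      "a \<in> Obj C \<Longrightarrow> Iso2 D (F\<^sub>0 a) (F\<^sub>0 a) (F\<^sub>1 a a (Ident C a)) (Ident D (F\<^sub>0 a))"
    and F_Comp:
      "\<lbrakk>a \<in> Obj C; b \<in> Obj C; c \<in> Obj C; f \<in> Hom C a b; g \<in> Hom C b c\<rbrakk>
        \<Longrightarrow> Iso2 D (F\<^sub>0 a) (F\<^sub>0 c) (F\<^sub>1 a c (Comp C a b c g f))
              (Comp D (F\<^sub>0 a) (F\<^sub>0 b) (F\<^sub>0 c) (F\<^sub>1 b c g) (F\<^sub>1 a b f))"

text \<open>The category of binary implicative arrow algebras whose carrier is a subset of the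
  type \<open>'a\<close>, which plays the role of the universe.\<close>

definition ArrAlg_bi :: "('a arrow_structure, 'a \<Rightarrow> 'a) enriched_structure" where
  "ArrAlg_bi =
     \<lparr> Obj = {A. binary_implicative A},
       Hom = (\<lambda>A B. {f. implicative_morphism A B f}),
       Leq = morphism_le,
       Comp = (\<lambda>A B C g f. compose (carrier A) g f),
       Ident = identity_morphism \<rparr>"


section \<open>The Sierpinski construction\<close>

definition sierpinski :: "'a arrow_structure \<Rightarrow> ('a \<times> 'a) arrow_structure" where
  "sierpinski A =
     \<lparr> carrier = {(x\<^sub>0, x\<^sub>1). x\<^sub>0 \<in> carrier A \<and> x\<^sub>1 \<in> carrier A \<and> x\<^sub>0 \<sqsubseteq>\<^bsub>A\<^esub> x\<^sub>1},
       eq = (=),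
       le = (\<lambda>(x\<^sub>0, x\<^sub>1) (y\<^sub>0, y\<^sub>1). x\<^sub>0 \<sqsubseteq>\<^bsub>A\<^esub> y\<^sub>0 \<and> x\<^sub>1 \<sqsubseteq>\<^bsub>A\<^esub> y\<^sub>1),
       imp = (\<lambda>(x\<^sub>0, x\<^sub>1) (y\<^sub>0, y\<^sub>1). ((x\<^sub>0 \<leadsto>\<^bsub>A\<^esub> y\<^sub>0) \<sqinter>\<^bsub>A\<^esub> (x\<^sub>1 \<leadsto>\<^bsub>A\<^esub> y\<^sub>1), x\<^sub>1 \<leadsto>\<^bsub>A\<^esub> y\<^sub>1)),
       separator = {(x\<^sub>0, x\<^sub>1). x\<^sub>0 \<in> carrier A \<and> x\<^sub>1 \<in> carrier A \<and> x\<^sub>0 \<sqsubseteq>\<^bsub>A\<^esub> x\<^sub>1 \<and> x\<^sub>0 \<in> separator A} \<rparr>"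

definition sierpinski_map ::
    "'a arrow_structure \<Rightarrow> 'b arrow_structure \<Rightarrow> ('a \<Rightarrow> 'b) \<Rightarrow> 'a \<times> 'a \<Rightarrow> 'b \<times> 'b" where
  "sierpinski_map A B f =
     (\<lambda>(x\<^sub>0, x\<^sub>1)\<in>carrier (sierpinski A).
        (\<Sqinter>\<^bsub>B\<^esub> {del B (f a) | a. a \<in> carrier A \<and> x\<^sub>0 \<sqsubseteq>\<^bsub>A\<^esub> a},
         \<Sqinter>\<^bsub>B\<^esub> {del B (f a) | a. a \<in> carrier A \<and> x\<^sub>1 \<sqsubseteq>\<^bsub>A\<^esub> a}))"

end

theory Submission
  imports Defs
begin

text \<open>The function \<open>sierpinski_map A B f\<close> is a composite of two constructions:
  first \<open>f\<close> is replaced by \<open>F x = \<Sqinter> {del B (f a) | x \<sqsubseteq> a}\<close>, its \<^emph>\<open>monotone hull\<close>, and then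
  \<open>F\<close> is applied to both components (\<open>pair_map\<close>). Monotonicity of \<open>F\<close> is what keeps the pairs
  \<open>x\<^sub>0 \<sqsubseteq> x\<^sub>1\<close> inside the Sierpinski algebra.

  On monotone implicative morphisms, \<open>pair_map\<close> preserves identities and composition on the nose.
  It preserves all the realizability conditions because the separator of the Sierpinski algebra
  only looks at the first component, and the first component of \<open>x \<leadsto> y\<close> is
  \<open>(x\<^sub>0 \<leadsto> y\<^sub>0) \<sqinter> (x\<^sub>1 \<leadsto> y\<^sub>1)\<close>: one element of the separator of \<open>A\<close> has to realize both
  implications. A family of implications in the Sierpinski algebra is thus a family over \<open>A\<close> that is
  indexed by the components of its entries, and conditions that are uniform in the index carry
  over. Distributivity of \<open>\<leadsto>\<close> over \<open>\<sqinter>\<close> makes this work for nested implications too, both for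
  the combinators of the Sierpinski algebra (\<open>arrow_algebra_sierpinski\<close>) and for the realizer of
  a pair map (\<open>implicative_pair_map\<close>).

  The monotone hull of \<open>f\<close> is isomorphic to \<open>f\<close> (\<open>hull_iso\<close>). Hence taking hulls
  preserves the order, identities and composition up to isomorphism, and the inequalities between
  composites that express an adjunction; applying \<open>pair_map\<close> gives all the claims.

  The isomorphism needs some logic inside an arrow algebra. A family is \<^emph>\<open>realized\<close> when its
  meet is in the separator. The combinators \<open>\<^bold>k\<close> and \<open>\<^bold>s\<close> are uniform, so they give
  the axioms of implicational logic for families, while modus ponens for families
  (\<open>realized_mp\<close>) comes from the combinator \<open>\<^bold>a\<close> and is confined to conclusions that are
  themselves implications. The deduction rules derived from these never leave such conclusions.\<close>

section \<open>Uniform realizability\<close>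

sublocale arrow_algebra \<subseteq> complete_lattice A
proof (rule complete_lattice_criterion1)
  show "\<exists>g. greatest A g (carrier A)"
    using meets_exist[of "{}"] by simp
  show "\<exists>i. greatest A i (Lower A X)" if "X \<subseteq> carrier A" for X
    using meets_exist[OF that] .
qed

text \<open>By \<open>inf_in_separator_iff_realized\<close>, this says that the meet of the family is in the
  separator. A single lower bound in the separator survives reindexing and
  can be compared across components of pairs, without any closure conditions.\<close>

definition realized :: "'a arrow_structure \<Rightarrow> 'i set \<Rightarrow> ('i \<Rightarrow> 'a) \<Rightarrow> bool" where
  "realized A I \<phi> \<longleftrightarrow> (\<exists>s\<in>separator A. \<forall>i\<in>I. s \<sqsubseteq>\<^bsub>A\<^esub> \<phi> i)"

lemma realized_reindex: "realized A J \<phi> \<Longrightarrow> g ` I \<subseteq> J \<Longrightarrow> realized A I (\<lambda>i. \<phi> (g i))"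
  unfolding realized_def by blast

lemma realized_cong: "(\<And>i. i \<in> I \<Longrightarrow> \<phi> i = \<psi> i) \<Longrightarrow> realized A I \<phi> = realized A I \<psi>"
  unfolding realized_def by simp

context arrow_algebra
begin

lemmas [simp] = imp_closed

lemma separator_carrier: "a \<in> separator A \<Longrightarrow> a \<in> carrier A"
  using separator_subset by blast

lemma imp_mono:
  assumes "a' \<sqsubseteq> a" "b \<sqsubseteq> b'" "a \<in> carrier A" "a' \<in> carrier A" "b \<in> carrier A" "b' \<in> carrier A"
  shows "a \<leadsto> b \<sqsubseteq> a' \<leadsto> b'"
  using imp_antitone[of a' a b] imp_monotone[of a' b b'] assms
  by (meson imp_closed le_trans)

lemma le_meet_iff:
  assumes "s \<in> carrier A" "a \<in> carrier A" "b \<in> carrier A"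
  shows "s \<sqsubseteq> a \<sqinter> b \<longleftrightarrow> s \<sqsubseteq> a \<and> s \<sqsubseteq> b"
  using assms by (meson meet_closed meet_le meet_left meet_right le_trans)

lemma inf_in_separator_iff:
  assumes "X \<subseteq> carrier A"
  shows "\<Sqinter> X \<in> separator A \<longleftrightarrow> (\<exists>s\<in>separator A. \<forall>x\<in>X. s \<sqsubseteq> x)"
  using assms separator_upward[of _ "\<Sqinter> X"]
  by (metis inf_closed inf_greatest inf_lower separator_carrier)

lemma inf_in_separator_iff_realized:
  assumes "\<And>i. i \<in> I \<Longrightarrow> \<phi> i \<in> carrier A"
  shows "\<Sqinter> (\<phi> ` I) \<in> separator A \<longleftrightarrow> realized A I \<phi>"
proof -
  have "\<phi> ` I \<subseteq> carrier A" using assms by blast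
  from inf_in_separator_iff[OF this] show ?thesis unfolding realized_def by simp
qed

lemma realized_mono:
  assumes "realized A I \<phi>" "\<And>i. i \<in> I \<Longrightarrow> \<phi> i \<sqsubseteq> \<psi> i"
    and "\<And>i. i \<in> I \<Longrightarrow> \<phi> i \<in> carrier A" "\<And>i. i \<in> I \<Longrightarrow> \<psi> i \<in> carrier A"
  shows "realized A I \<psi>"
  using assms separator_carrier le_trans unfolding realized_def by meson

lemma realized_separator: "realized A I \<phi> \<Longrightarrow> i \<in> I \<Longrightarrow> \<phi> i \<in> carrier A \<Longrightarrow> \<phi> i \<in> separator A"
  using separator_upward unfolding realized_def by blast

lemma comb_k_le:
  assumes "a \<in> carrier A" "b \<in> carrier A"
  shows "comb_k A \<sqsubseteq> a \<leadsto> b \<leadsto> a"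
  unfolding comb_k_def using assms by (intro inf_lower) auto

lemma comb_s_le:
  assumes "a \<in> carrier A" "b \<in> carrier A" "c \<in> carrier A"
  shows "comb_s A \<sqsubseteq> (a \<leadsto> b \<leadsto> c) \<leadsto> (a \<leadsto> b) \<leadsto> a \<leadsto> c"
  unfolding comb_s_def using assms by (intro inf_lower) auto

lemma comb_a_entry_closed:
  assumes "a \<in> carrier A" "Y \<subseteq> carrier A \<times> carrier A"
  shows "comb_a_entry A a Y \<in> carrier A"
  unfolding comb_a_entry_def using assms
  by (intro imp_closed inf_closed) auto

lemma comb_a_le:
  assumes "a \<in> carrier A" "Y \<subseteq> carrier A \<times> carrier A"
  shows "comb_a A \<sqsubseteq> comb_a_entry A a Y"
  unfolding comb_a_def using assms comb_a_entry_closed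
  by (intro inf_lower) auto

lemma comb_a_le_family:
  assumes "a \<in> carrier A" "\<And>i. i \<in> I \<Longrightarrow> \<psi> i \<in> carrier A" "\<And>i. i \<in> I \<Longrightarrow> \<chi> i \<in> carrier A"
  shows "comb_a A \<sqsubseteq> (\<Sqinter> ((\<lambda>i. a \<leadsto> \<psi> i \<leadsto> \<chi> i) ` I)) \<leadsto> a \<leadsto> \<Sqinter> ((\<lambda>i. \<psi> i \<leadsto> \<chi> i) ` I)"
proof -
  have "(\<lambda>i. (\<psi> i, \<chi> i)) ` I \<subseteq> carrier A \<times> carrier A"
    using assms(2,3) by blast
  from comb_a_le[OF assms(1) this] show ?thesis
    unfolding comb_a_entry_family .
qed

lemma realized_k:
  assumes "\<And>i. i \<in> I \<Longrightarrow> \<phi> i \<in> carrier A" "\<And>i. i \<in> I \<Longrightarrow> \<psi> i \<in> carrier A"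
  shows "realized A I (\<lambda>i. \<phi> i \<leadsto> \<psi> i \<leadsto> \<phi> i)"
  unfolding realized_def by (intro bexI[OF _ separator_k] ballI comb_k_le assms)

lemma realized_s:
  assumes "\<And>i. i \<in> I \<Longrightarrow> \<phi> i \<in> carrier A" "\<And>i. i \<in> I \<Longrightarrow> \<psi> i \<in> carrier A"
    "\<And>i. i \<in> I \<Longrightarrow> \<chi> i \<in> carrier A"
  shows "realized A I (\<lambda>i. (\<phi> i \<leadsto> \<psi> i \<leadsto> \<chi> i) \<leadsto> (\<phi> i \<leadsto> \<psi> i) \<leadsto> \<phi> i \<leadsto> \<chi> i)"
  unfolding realized_def by (intro bexI[OF _ separator_s] ballI comb_s_le assms)

text \<open>Let \<open>t\<close> be a realizer of \<open>\<phi>\<close>. Replacing every \<open>\<phi> i\<close> by the constant \<open>t\<close> leaves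
  a family in which the first argument does not depend on the index, and the combinator \<open>\<^bold>a\<close> pulls it
  out of the meet. That the conclusion be an implication is forced by the form of \<open>\<^bold>a\<close>.\<close>

lemma realized_mp:
  assumes major: "realized A I (\<lambda>i. \<phi> i \<leadsto> \<psi> i \<leadsto> \<chi> i)" and minor: "realized A I \<phi>"
    and cl: "\<And>i. i \<in> I \<Longrightarrow> \<phi> i \<in> carrier A" "\<And>i. i \<in> I \<Longrightarrow> \<psi> i \<in> carrier A"
    "\<And>i. i \<in> I \<Longrightarrow> \<chi> i \<in> carrier A"
  shows "realized A I (\<lambda>i. \<psi> i \<leadsto> \<chi> i)"
proof -
  obtain t where t: "t \<in> separator A" "\<forall>i\<in>I. t \<sqsubseteq> \<phi> i"
    using minor unfolding realized_def by blast
  have tc: "t \<in> carrier A" using t separator_carrier by blast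
  let ?P = "\<Sqinter> ((\<lambda>i. t \<leadsto> \<psi> i \<leadsto> \<chi> i) ` I)"
  let ?Q = "\<Sqinter> ((\<lambda>i. \<psi> i \<leadsto> \<chi> i) ` I)"
  have "realized A I (\<lambda>i. t \<leadsto> \<psi> i \<leadsto> \<chi> i)"
    by (rule realized_mono[OF major]) (use t tc cl in \<open>auto intro: imp_antitone\<close>)
  then have P: "?P \<in> separator A"
    by (subst inf_in_separator_iff_realized) (use tc cl in auto)
  have Qc: "?Q \<in> carrier A" by (rule inf_closed) (use cl in auto)
  have "?P \<leadsto> t \<leadsto> ?Q \<in> separator A"
    using comb_a_le_family[OF tc, of I \<psi> \<chi>] separator_a separator_upward P Qc tc cl
    by (meson imp_closed separator_carrier)
  then have "?Q \<in> separator A"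
    using separator_mp P t tc Qc by (meson imp_closed separator_carrier)
  then show ?thesis
    by (subst (asm) inf_in_separator_iff_realized) (use cl in auto)
qed

lemma realized_weaken:
  assumes "realized A I (\<lambda>i. \<psi> i \<leadsto> \<chi> i)"
    and "\<And>i. i \<in> I \<Longrightarrow> \<phi> i \<in> carrier A" "\<And>i. i \<in> I \<Longrightarrow> \<psi> i \<in> carrier A"
    "\<And>i. i \<in> I \<Longrightarrow> \<chi> i \<in> carrier A"
  shows "realized A I (\<lambda>i. \<phi> i \<leadsto> \<psi> i \<leadsto> \<chi> i)"
  by (rule realized_mp[OF realized_k assms(1)]) (use assms(2-4) in auto)

lemma realized_mp_under:
  assumes "realized A I (\<lambda>i. \<phi> i \<leadsto> \<psi> i \<leadsto> \<chi> i)" "realized A I (\<lambda>i. \<phi> i \<leadsto> \<psi> i)"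
    and cl: "\<And>i. i \<in> I \<Longrightarrow> \<phi> i \<in> carrier A" "\<And>i. i \<in> I \<Longrightarrow> \<psi> i \<in> carrier A"
    "\<And>i. i \<in> I \<Longrightarrow> \<chi> i \<in> carrier A"
  shows "realized A I (\<lambda>i. \<phi> i \<leadsto> \<chi> i)"
proof -
  have "realized A I (\<lambda>i. (\<phi> i \<leadsto> \<psi> i) \<leadsto> \<phi> i \<leadsto> \<chi> i)"
    by (rule realized_mp[OF realized_s assms(1)]) (use cl in auto)
  then show ?thesis
    by (rule realized_mp[OF _ assms(2)]) (use cl in auto)
qed

lemma realized_id:
  assumes "\<And>i. i \<in> I \<Longrightarrow> \<phi> i \<in> carrier A"
  shows "realized A I (\<lambda>i. \<phi> i \<leadsto> \<phi> i)"
  by (rule realized_mp_under[where \<psi> = "\<lambda>i. \<phi> i \<leadsto> \<phi> i"])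
    (use assms in \<open>auto intro: realized_k\<close>)

lemma realized_le:
  assumes "\<And>i. i \<in> I \<Longrightarrow> \<phi> i \<sqsubseteq> \<psi> i"
    and "\<And>i. i \<in> I \<Longrightarrow> \<phi> i \<in> carrier A" "\<And>i. i \<in> I \<Longrightarrow> \<psi> i \<in> carrier A"
  shows "realized A I (\<lambda>i. \<phi> i \<leadsto> \<psi> i)"
  by (rule realized_mono[OF realized_id[of I \<phi>]]) (use assms in \<open>auto intro: imp_monotone\<close>)

lemma realized_trans:
  assumes "realized A I (\<lambda>i. \<phi> i \<leadsto> \<psi> i)" "realized A I (\<lambda>i. \<psi> i \<leadsto> \<chi> i)"
    and "\<And>i. i \<in> I \<Longrightarrow> \<phi> i \<in> carrier A" "\<And>i. i \<in> I \<Longrightarrow> \<psi> i \<in> carrier A"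
    "\<And>i. i \<in> I \<Longrightarrow> \<chi> i \<in> carrier A"
  shows "realized A I (\<lambda>i. \<phi> i \<leadsto> \<chi> i)"
  by (rule realized_mp_under[OF realized_weaken assms(1)]) (use assms in auto)

text \<open>Composition before and after, internalised: the combinator term is
  \<open>\<lambda>p x. v (p (u x))\<close> for realizers \<open>u\<close>, \<open>v\<close> of the hypotheses, compiled into
  \<open>\<^bold>s\<close> and \<open>\<^bold>k\<close>.\<close>

lemma realized_imp_imp:
  assumes "realized A I (\<lambda>i. \<phi>' i \<leadsto> \<phi> i)" "realized A I (\<lambda>i. \<psi> i \<leadsto> \<psi>' i)"
    and cl: "\<And>i. i \<in> I \<Longrightarrow> \<phi> i \<in> carrier A" "\<And>i. i \<in> I \<Longrightarrow> \<phi>' i \<in> carrier A"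
    "\<And>i. i \<in> I \<Longrightarrow> \<psi> i \<in> carrier A" "\<And>i. i \<in> I \<Longrightarrow> \<psi>' i \<in> carrier A"
  shows "realized A I (\<lambda>i. (\<phi> i \<leadsto> \<psi> i) \<leadsto> \<phi>' i \<leadsto> \<psi>' i)"
proof -
  let ?p = "\<lambda>i. \<phi> i \<leadsto> \<psi> i"
  have 1: "realized A I (\<lambda>i. \<phi>' i \<leadsto> \<psi> i \<leadsto> \<psi>' i)"
    by (rule realized_weaken[OF assms(2)]) (use cl in auto)
  have 2: "realized A I (\<lambda>i. (\<phi>' i \<leadsto> \<psi> i) \<leadsto> \<phi>' i \<leadsto> \<psi>' i)"
    by (rule realized_mp[OF realized_s 1]) (use cl in auto)
  have 3: "realized A I (\<lambda>i. ?p i \<leadsto> \<phi>' i \<leadsto> \<phi> i)"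
    by (rule realized_weaken[OF assms(1)]) (use cl in auto)
  have 4: "realized A I (\<lambda>i. ?p i \<leadsto> \<phi>' i \<leadsto> ?p i)"
    by (rule realized_k) (use cl in auto)
  have 5: "realized A I (\<lambda>i. ?p i \<leadsto> (\<phi>' i \<leadsto> \<phi> i) \<leadsto> \<phi>' i \<leadsto> \<psi> i)"
    by (rule realized_trans[OF 4 realized_s]) (use cl in auto)
  have 6: "realized A I (\<lambda>i. ?p i \<leadsto> \<phi>' i \<leadsto> \<psi> i)"
    by (rule realized_mp_under[OF 5 3]) (use cl in auto)
  show ?thesis
    by (rule realized_trans[OF 6 2]) (use cl in auto)
qed

text \<open>Generalization over \<open>j\<close>: the combinator \<open>\<^bold>a\<close> moves a meet of implications
  under \<open>\<phi> i \<leadsto> _\<close>, uniformly in \<open>i\<close>.\<close>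

lemma realized_imp_inf:
  assumes hyp: "realized A (Sigma I J) (\<lambda>(i, j). \<phi> i \<leadsto> \<psi> i j \<leadsto> \<chi> i j)"
    and cl: "\<And>i. i \<in> I \<Longrightarrow> \<phi> i \<in> carrier A"
    "\<And>i j. i \<in> I \<Longrightarrow> j \<in> J i \<Longrightarrow> \<psi> i j \<in> carrier A" "\<And>i j. i \<in> I \<Longrightarrow> j \<in> J i \<Longrightarrow> \<chi> i j \<in> carrier A"
  shows "realized A I (\<lambda>i. \<phi> i \<leadsto> \<Sqinter> ((\<lambda>j. \<psi> i j \<leadsto> \<chi> i j) ` J i))"
proof (rule realized_mp)
  let ?P = "\<lambda>i. \<Sqinter> ((\<lambda>j. \<phi> i \<leadsto> \<psi> i j \<leadsto> \<chi> i j) ` J i)"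
  have sub: "(\<lambda>j. \<phi> i \<leadsto> \<psi> i j \<leadsto> \<chi> i j) ` J i \<subseteq> carrier A" if "i \<in> I" for i
    using cl that by auto
  show "realized A I (\<lambda>i. ?P i \<leadsto> \<phi> i \<leadsto> \<Sqinter> ((\<lambda>j. \<psi> i j \<leadsto> \<chi> i j) ` J i))"
    unfolding realized_def by (intro bexI[OF _ separator_a] ballI comb_a_le_family cl)
  obtain s where s: "s \<in> separator A" "\<forall>i\<in>I. \<forall>j\<in>J i. s \<sqsubseteq> \<phi> i \<leadsto> \<psi> i j \<leadsto> \<chi> i j"
    using hyp unfolding realized_def by fastforce
  have "\<forall>i\<in>I. s \<sqsubseteq> ?P i"
    using s cl separator_carrier by (auto intro!: inf_greatest)
  then show "realized A I ?P"
    unfolding realized_def using s by blast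
  show "?P i \<in> carrier A" if "i \<in> I" for i using sub[OF that] by simp
  show "\<Sqinter> ((\<lambda>j. \<psi> i j \<leadsto> \<chi> i j) ` J i) \<in> carrier A" if "i \<in> I" for i
    using cl that by (intro inf_closed) auto
qed (use cl in auto)

lemma del_closed [simp]: "a \<in> carrier A \<Longrightarrow> del A a \<in> carrier A"
  unfolding del_def by simp

lemma top_in_separator: "\<top> \<in> separator A"
  using separator_k separator_upward separator_carrier by (meson top_closed top_higher)

text \<open>Since \<open>\<top>\<close> is in the separator, \<open>del A a = \<top> \<leadsto> a\<close> is logically the same as
  \<open>a\<close>. Its use is that it is an implication, so that meets of such elements are accessible to
  \<open>\<^bold>a\<close>.\<close>

lemma realized_del_elim:
  assumes cl: "\<And>i. i \<in> I \<Longrightarrow> \<phi> i \<in> carrier A"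
  shows "realized A I (\<lambda>i. del A (\<phi> i) \<leadsto> \<phi> i)"
proof (rule realized_mp_under)
  have "realized A I (\<lambda>_. \<top>)"
    unfolding realized_def using top_in_separator by auto
  from realized_mp[OF realized_k[of I "\<lambda>_. \<top>" "\<lambda>i. del A (\<phi> i)"] this]
  show "realized A I (\<lambda>i. del A (\<phi> i) \<leadsto> \<top>)"
    using cl by simp
  show "realized A I (\<lambda>i. del A (\<phi> i) \<leadsto> \<top> \<leadsto> \<phi> i)"
    using realized_id[of I "\<lambda>i. del A (\<phi> i)"] cl unfolding del_def by simp
qed (use cl in auto)

lemma realized_del_intro:
  assumes cl: "\<And>i. i \<in> I \<Longrightarrow> \<phi> i \<in> carrier A"
  shows "realized A I (\<lambda>i. \<phi> i \<leadsto> del A (\<phi> i))"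
  unfolding del_def by (rule realized_k) (use cl in auto)

end

section \<open>Implicative morphisms\<close>

lemma morphism_le_iff_realized:
  assumes "arrow_algebra B" "f \<in> carrier A \<rightarrow> carrier B" "g \<in> carrier A \<rightarrow> carrier B"
  shows "morphism_le A B f g \<longleftrightarrow> realized B (carrier A) (\<lambda>a. f a \<leadsto>\<^bsub>B\<^esub> g a)"
proof -
  interpret B: arrow_algebra B by fact
  show ?thesis
    using B.inf_in_separator_iff_realized[of "carrier A" "\<lambda>a. f a \<leadsto>\<^bsub>B\<^esub> g a"] assms(2,3)
    by (simp add: morphism_le_def Setcompr_eq_image Pi_iff)
qed

lemma inf_pairs_in_separator_iff_realized:
  assumes "arrow_algebra B" "f \<in> carrier A \<rightarrow> carrier B" "X \<subseteq> carrier A \<times> carrier A"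
  shows "\<Sqinter>\<^bsub>B\<^esub> {f a \<leadsto>\<^bsub>B\<^esub> f a' | a a'. (a, a') \<in> X} \<in> separator B \<longleftrightarrow>
    realized B X (\<lambda>(a, a'). f a \<leadsto>\<^bsub>B\<^esub> f a')"
proof -
  interpret B: arrow_algebra B by fact
  have "{f a \<leadsto>\<^bsub>B\<^esub> f a' | a a'. (a, a') \<in> X} = (\<lambda>(a, a'). f a \<leadsto>\<^bsub>B\<^esub> f a') ` X"
    by force
  then show ?thesis
    using B.inf_in_separator_iff_realized[of X "\<lambda>(a, a'). f a \<leadsto>\<^bsub>B\<^esub> f a'"] assms(2,3)
    by (fastforce simp: Pi_iff)
qed

lemma implicative_morphism_iff_realized:
  assumes A: "arrow_algebra A" and B: "arrow_algebra B"
  shows "implicative_morphism A B f \<longleftrightarrow>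
    f \<in> carrier A \<rightarrow>\<^sub>E carrier B \<and> (\<forall>a\<in>separator A. f a \<in> separator B) \<and>
    realized B (carrier A \<times> carrier A) (\<lambda>(a, a'). f (a \<leadsto>\<^bsub>A\<^esub> a') \<leadsto>\<^bsub>B\<^esub> f a \<leadsto>\<^bsub>B\<^esub> f a') \<and>
    (\<forall>X \<subseteq> carrier A \<times> carrier A. realized A X (\<lambda>(a, a'). a \<leadsto>\<^bsub>A\<^esub> a') \<longrightarrow>
      realized B X (\<lambda>(a, a'). f a \<leadsto>\<^bsub>B\<^esub> f a'))"
proof (cases "f \<in> carrier A \<rightarrow>\<^sub>E carrier B")
  case True
  then have f: "f \<in> carrier A \<rightarrow> carrier B" by (auto simp: PiE_def)
  have 1: "\<Sqinter>\<^bsub>A\<^esub> {a \<leadsto>\<^bsub>A\<^esub> a' | a a'. (a, a') \<in> X} \<in> separator A \<longleftrightarrow> realized A X (\<lambda>(a, a'). a \<leadsto>\<^bsub>A\<^esub> a')"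
    if "X \<subseteq> carrier A \<times> carrier A" for X
    using inf_pairs_in_separator_iff_realized[OF A, of "\<lambda>a. a" A X] that by simp
  show ?thesis
    unfolding implicative_morphism_def
    using 1 inf_pairs_in_separator_iff_realized[OF B f] True
    by (auto simp: realized_def)
qed (simp add: implicative_morphism_def)

locale implicative = A: arrow_algebra A + B: arrow_algebra B
  for A :: "'a arrow_structure" and B :: "'b arrow_structure" and f :: "'a \<Rightarrow> 'b" +
  assumes implicative: "implicative_morphism A B f"
begin

lemma extensional_funcset: "f \<in> carrier A \<rightarrow>\<^sub>E carrier B"
  using implicative by (simp add: implicative_morphism_def)

lemma funcset: "f \<in> carrier A \<rightarrow> carrier B"
  using extensional_funcset by (auto simp: PiE_def)

lemma closed [simp]: "a \<in> carrier A \<Longrightarrow> f a \<in> carrier B"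
  using funcset by auto

lemma preserves_separator: "a \<in> separator A \<Longrightarrow> f a \<in> separator B"
  using implicative by (simp add: implicative_morphism_def)

lemma realized_app:
  assumes "\<And>i. i \<in> I \<Longrightarrow> \<phi> i \<in> carrier A" "\<And>i. i \<in> I \<Longrightarrow> \<psi> i \<in> carrier A"
  shows "realized B I (\<lambda>i. f (\<phi> i \<leadsto>\<^bsub>A\<^esub> \<psi> i) \<leadsto>\<^bsub>B\<^esub> f (\<phi> i) \<leadsto>\<^bsub>B\<^esub> f (\<psi> i))"
  using implicative assms
    realized_reindex[of B "carrier A \<times> carrier A"
      "\<lambda>(a, a'). f (a \<leadsto>\<^bsub>A\<^esub> a') \<leadsto>\<^bsub>B\<^esub> f a \<leadsto>\<^bsub>B\<^esub> f a'" "\<lambda>i. (\<phi> i, \<psi> i)" I]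
  by (auto simp: implicative_morphism_iff_realized[OF A.arrow_algebra_axioms B.arrow_algebra_axioms])

lemma realized_map:
  assumes "realized A I (\<lambda>i. \<phi> i \<leadsto>\<^bsub>A\<^esub> \<psi> i)"
    and "\<And>i. i \<in> I \<Longrightarrow> \<phi> i \<in> carrier A" "\<And>i. i \<in> I \<Longrightarrow> \<psi> i \<in> carrier A"
  shows "realized B I (\<lambda>i. f (\<phi> i) \<leadsto>\<^bsub>B\<^esub> f (\<psi> i))"
proof -
  let ?X = "(\<lambda>i. (\<phi> i, \<psi> i)) ` I"
  have "?X \<subseteq> carrier A \<times> carrier A" "realized A ?X (\<lambda>(a, a'). a \<leadsto>\<^bsub>A\<^esub> a')"
    using assms by (auto simp: realized_def)
  then have "realized B ?X (\<lambda>(a, a'). f a \<leadsto>\<^bsub>B\<^esub> f a')"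
    using implicative
    by (simp add: implicative_morphism_iff_realized[OF A.arrow_algebra_axioms B.arrow_algebra_axioms])
  then show ?thesis
    by (auto simp: realized_def)
qed

end

lemma implicative_morphismI:
  assumes A: "arrow_algebra A" and B: "arrow_algebra B"
    and "f \<in> carrier A \<rightarrow>\<^sub>E carrier B" "\<And>a. a \<in> separator A \<Longrightarrow> f a \<in> separator B"
    and "realized B (carrier A \<times> carrier A) (\<lambda>p. f (fst p \<leadsto>\<^bsub>A\<^esub> snd p) \<leadsto>\<^bsub>B\<^esub> f (fst p) \<leadsto>\<^bsub>B\<^esub> f (snd p))"
    and "\<And>X. \<lbrakk>X \<subseteq> carrier A \<times> carrier A; realized A X (\<lambda>p. fst p \<leadsto>\<^bsub>A\<^esub> snd p)\<rbrakk>
      \<Longrightarrow> realized B X (\<lambda>p. f (fst p) \<leadsto>\<^bsub>B\<^esub> f (snd p))"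
  shows "implicative_morphism A B f"
  using assms(3-) unfolding implicative_morphism_iff_realized[OF A B] by (simp add: case_prod_unfold)

lemma implicative_identity:
  assumes "arrow_algebra A"
  shows "implicative_morphism A A (identity_morphism A)"
proof -
  interpret A: arrow_algebra A by fact
  show ?thesis
  proof (rule implicative_morphismI[OF assms assms])
    show "realized A (carrier A \<times> carrier A) (\<lambda>p. identity_morphism A (fst p \<leadsto>\<^bsub>A\<^esub> snd p) \<leadsto>\<^bsub>A\<^esub>
        identity_morphism A (fst p) \<leadsto>\<^bsub>A\<^esub> identity_morphism A (snd p))"
      using A.realized_id[of "carrier A \<times> carrier A" "\<lambda>p. fst p \<leadsto>\<^bsub>A\<^esub> snd p"]
      by (subst realized_cong[where \<psi> = "\<lambda>p. (fst p \<leadsto>\<^bsub>A\<^esub> snd p) \<leadsto>\<^bsub>A\<^esub> fst p \<leadsto>\<^bsub>A\<^esub> snd p"])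
        (auto simp: identity_morphism_def)
    show "realized A X (\<lambda>p. identity_morphism A (fst p) \<leadsto>\<^bsub>A\<^esub> identity_morphism A (snd p))"
      if "X \<subseteq> carrier A \<times> carrier A" "realized A X (\<lambda>p. fst p \<leadsto>\<^bsub>A\<^esub> snd p)" for X
      using that by (subst realized_cong[where \<psi> = "\<lambda>p. fst p \<leadsto>\<^bsub>A\<^esub> snd p"])
        (auto simp: identity_morphism_def)
  qed (auto simp: identity_morphism_def A.separator_carrier)
qed

lemma implicative_compose:
  assumes A: "arrow_algebra A" and B: "arrow_algebra B" and C: "arrow_algebra C"
    and f: "implicative_morphism A B f" and g: "implicative_morphism B C g"
  shows "implicative_morphism A C (compose (carrier A) g f)"
proof -
  interpret f: implicative A B f by (intro implicative.intro implicative_axioms.intro A B f)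
  interpret g: implicative B C g by (intro implicative.intro implicative_axioms.intro B C g)
  show ?thesis
  proof (rule implicative_morphismI[OF A C])
    show "compose (carrier A) g f \<in> carrier A \<rightarrow>\<^sub>E carrier C"
      by (auto simp: compose_def)
    show "compose (carrier A) g f a \<in> separator C" if "a \<in> separator A" for a
      using that f.A.separator_carrier by (simp add: compose_eq f.preserves_separator g.preserves_separator)
    let ?I = "carrier A \<times> carrier A"
    have "realized C ?I (\<lambda>p. g (f (fst p \<leadsto>\<^bsub>A\<^esub> snd p)) \<leadsto>\<^bsub>C\<^esub> g (f (fst p) \<leadsto>\<^bsub>B\<^esub> f (snd p)))"
      by (rule g.realized_map[OF f.realized_app]) auto
    then have "realized C ?I (\<lambda>p. g (f (fst p \<leadsto>\<^bsub>A\<^esub> snd p)) \<leadsto>\<^bsub>C\<^esub> g (f (fst p)) \<leadsto>\<^bsub>C\<^esub> g (f (snd p)))"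
      by (rule g.B.realized_trans[OF _ g.realized_app]) auto
    then show "realized C ?I (\<lambda>p. compose (carrier A) g f (fst p \<leadsto>\<^bsub>A\<^esub> snd p) \<leadsto>\<^bsub>C\<^esub>
        compose (carrier A) g f (fst p) \<leadsto>\<^bsub>C\<^esub> compose (carrier A) g f (snd p))"
      by (subst realized_cong[where \<psi> =
            "\<lambda>p. g (f (fst p \<leadsto>\<^bsub>A\<^esub> snd p)) \<leadsto>\<^bsub>C\<^esub> g (f (fst p)) \<leadsto>\<^bsub>C\<^esub> g (f (snd p))"])
        (auto simp: compose_eq)
    show "realized C X (\<lambda>p. compose (carrier A) g f (fst p) \<leadsto>\<^bsub>C\<^esub> compose (carrier A) g f (snd p))"
      if X: "X \<subseteq> carrier A \<times> carrier A" "realized A X (\<lambda>p. fst p \<leadsto>\<^bsub>A\<^esub> snd p)" for X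
    proof -
      have "realized C X (\<lambda>p. g (f (fst p)) \<leadsto>\<^bsub>C\<^esub> g (f (snd p)))"
        by (rule g.realized_map[OF f.realized_map[OF X(2)]]) (use X(1) in auto)
      then show ?thesis
        by (subst realized_cong[where \<psi> = "\<lambda>p. g (f (fst p)) \<leadsto>\<^bsub>C\<^esub> g (f (snd p))"])
          (use X(1) in \<open>auto simp: compose_eq\<close>)
    qed
  qed
qed

text \<open>Membership in the separator transfers along the isomorphism by modus ponens. The other two
  conditions are about realized implications, which compose with those of the isomorphism.\<close>

lemma implicative_iso:
  assumes A: "arrow_algebra A" and B: "arrow_algebra B"
    and f: "implicative_morphism A B f" and g: "g \<in> carrier A \<rightarrow>\<^sub>E carrier B"
    and iso: "morphism_iso A B f g"
  shows "implicative_morphism A B g"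
proof -
  interpret f: implicative A B f by (intro implicative.intro implicative_axioms.intro A B f)
  have gc: "g \<in> carrier A \<rightarrow> carrier B" using g by (auto simp: PiE_def)
  then have [simp]: "a \<in> carrier A \<Longrightarrow> g a \<in> carrier B" for a by auto
  have fg: "realized B (carrier A) (\<lambda>a. f a \<leadsto>\<^bsub>B\<^esub> g a)"
    and gf: "realized B (carrier A) (\<lambda>a. g a \<leadsto>\<^bsub>B\<^esub> f a)"
    using iso morphism_le_iff_realized[OF B f.funcset gc] morphism_le_iff_realized[OF B gc f.funcset]
    by (simp_all add: morphism_iso_def)
  have fg': "realized B I (\<lambda>i. f (\<phi> i) \<leadsto>\<^bsub>B\<^esub> g (\<phi> i))"
    and gf': "realized B I (\<lambda>i. g (\<phi> i) \<leadsto>\<^bsub>B\<^esub> f (\<phi> i))"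
    if "\<And>i. i \<in> I \<Longrightarrow> \<phi> i \<in> carrier A" for I and \<phi> :: "'a \<times> 'a \<Rightarrow> 'a"
    using realized_reindex[OF fg, of \<phi> I] realized_reindex[OF gf, of \<phi> I] that by blast+
  show ?thesis
  proof (rule implicative_morphismI[OF A B g])
    show "g a \<in> separator B" if a: "a \<in> separator A" for a
    proof -
      have "f a \<leadsto>\<^bsub>B\<^esub> g a \<in> separator B"
        using f.B.realized_separator[OF fg, of a] f.A.separator_carrier[OF a] by simp
      then show ?thesis
        using f.B.separator_mp[of "f a" "g a"] f.preserves_separator[OF a] f.A.separator_carrier[OF a]
        by simp
    qed
    let ?I = "carrier A \<times> carrier A"
    have 1: "realized B ?I (\<lambda>p. g (fst p \<leadsto>\<^bsub>A\<^esub> snd p) \<leadsto>\<^bsub>B\<^esub> f (fst p) \<leadsto>\<^bsub>B\<^esub> f (snd p))"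
      by (rule f.B.realized_trans[OF gf' f.realized_app]) auto
    have 2: "realized B ?I (\<lambda>p. (f (fst p) \<leadsto>\<^bsub>B\<^esub> f (snd p)) \<leadsto>\<^bsub>B\<^esub> g (fst p) \<leadsto>\<^bsub>B\<^esub> g (snd p))"
      by (rule f.B.realized_imp_imp[OF gf' fg']) auto
    show "realized B ?I (\<lambda>p. g (fst p \<leadsto>\<^bsub>A\<^esub> snd p) \<leadsto>\<^bsub>B\<^esub> g (fst p) \<leadsto>\<^bsub>B\<^esub> g (snd p))"
      by (rule f.B.realized_trans[OF 1 2]) auto
    show "realized B X (\<lambda>p. g (fst p) \<leadsto>\<^bsub>B\<^esub> g (snd p))"
      if X: "X \<subseteq> carrier A \<times> carrier A" "realized A X (\<lambda>p. fst p \<leadsto>\<^bsub>A\<^esub> snd p)" for X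
    proof -
      have Xc: "p \<in> X \<Longrightarrow> fst p \<in> carrier A" "p \<in> X \<Longrightarrow> snd p \<in> carrier A" for p
        using X(1) by auto
      have 1: "realized B X (\<lambda>p. g (fst p) \<leadsto>\<^bsub>B\<^esub> f (snd p))"
        by (rule f.B.realized_trans[OF gf' f.realized_map[OF X(2)]]) (use Xc in auto)
      show ?thesis
        by (rule f.B.realized_trans[OF 1 fg']) (use Xc in auto)
    qed
  qed
qed

lemma morphism_le_refl:
  assumes "arrow_algebra B" "f \<in> carrier A \<rightarrow> carrier B"
  shows "morphism_le A B f f"
proof -
  interpret B: arrow_algebra B by fact
  show ?thesis
    using B.realized_id[of "carrier A" f] assms by (auto simp: morphism_le_iff_realized)
qed

lemma morphism_le_trans:
  assumes B: "arrow_algebra B"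
    and c: "f \<in> carrier A \<rightarrow> carrier B" "g \<in> carrier A \<rightarrow> carrier B" "h \<in> carrier A \<rightarrow> carrier B"
    and "morphism_le A B f g" "morphism_le A B g h"
  shows "morphism_le A B f h"
proof -
  interpret B: arrow_algebra B by fact
  show ?thesis
    using B.realized_trans[of "carrier A" f g h] assms by (auto simp: morphism_le_iff_realized Pi_iff)
qed

lemma morphism_le_compose:
  assumes B: "arrow_algebra B" and C: "arrow_algebra C"
    and f: "f \<in> carrier A \<rightarrow> carrier B" "f' \<in> carrier A \<rightarrow> carrier B"
    and g: "implicative_morphism B C g" and g': "g' \<in> carrier B \<rightarrow> carrier C"
    and ff': "morphism_le A B f f'" and gg': "morphism_le B C g g'"
  shows "morphism_le A C (compose (carrier A) g f) (compose (carrier A) g' f')"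
proof -
  interpret g: implicative B C g by (intro implicative.intro implicative_axioms.intro B C g)
  have fc [simp]: "a \<in> carrier A \<Longrightarrow> f a \<in> carrier B" "a \<in> carrier A \<Longrightarrow> f' a \<in> carrier B" for a
    using f by auto
  have gc [simp]: "b \<in> carrier B \<Longrightarrow> g' b \<in> carrier C" for b using g' by auto
  have "realized B (carrier A) (\<lambda>a. f a \<leadsto>\<^bsub>B\<^esub> f' a)"
    using ff' morphism_le_iff_realized[OF B f] by simp
  then have 1: "realized C (carrier A) (\<lambda>a. g (f a) \<leadsto>\<^bsub>C\<^esub> g (f' a))"
    by (rule g.realized_map) auto
  have "realized C (carrier B) (\<lambda>b. g b \<leadsto>\<^bsub>C\<^esub> g' b)"
    using gg' morphism_le_iff_realized[OF C g.funcset g'] by simp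
  then have 2: "realized C (carrier A) (\<lambda>a. g (f' a) \<leadsto>\<^bsub>C\<^esub> g' (f' a))"
    using realized_reindex[of C "carrier B" _ f' "carrier A"] by fastforce
  have 3: "realized C (carrier A) (\<lambda>a. g (f a) \<leadsto>\<^bsub>C\<^esub> g' (f' a))"
    by (rule g.B.realized_trans[OF 1 2]) auto
  have c: "compose (carrier A) g f \<in> carrier A \<rightarrow> carrier C"
    "compose (carrier A) g' f' \<in> carrier A \<rightarrow> carrier C"
    by (auto simp: compose_eq)
  show ?thesis
    unfolding morphism_le_iff_realized[OF C c]
    using 3 by (subst realized_cong[where \<psi> = "\<lambda>a. g (f a) \<leadsto>\<^bsub>C\<^esub> g' (f' a)"]) (auto simp: compose_eq)
qed

lemma preorder_enriched_category_ArrAlg_bi: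
  "preorder_enriched_category (ArrAlg_bi :: ('a arrow_structure, 'a \<Rightarrow> 'a) enriched_structure)"
    (is "preorder_enriched_category ?C")
proof -
  have obj: "arrow_algebra A" if "A \<in> Obj ?C" for A
    using that by (simp add: binary_implicative_def ArrAlg_bi_def)
  have hom: "implicative_morphism A B f" "f \<in> carrier A \<rightarrow> carrier B" "f \<in> extensional (carrier A)"
    if "f \<in> Hom ?C A B" for A B f
    using that by (auto simp: implicative_morphism_def PiE_def ArrAlg_bi_def)
  have [simp]: "Ident ?C = identity_morphism" "Leq ?C = morphism_le"
    "Comp ?C A B C g f = compose (carrier A) g f" "f \<in> Hom ?C A B \<longleftrightarrow> implicative_morphism A B f"
    for A B C f g
    by (simp_all add: ArrAlg_bi_def)
  show ?thesis
  proof (rule preorder_enriched_category.intro)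
    fix a b c d f f' g g' h
    show "a \<in> Obj ?C \<Longrightarrow> Ident ?C a \<in> Hom ?C a a"
      by (simp add: implicative_identity obj)
    show "\<lbrakk>a \<in> Obj ?C; b \<in> Obj ?C; c \<in> Obj ?C; f \<in> Hom ?C a b; g \<in> Hom ?C b c\<rbrakk>
        \<Longrightarrow> Comp ?C a b c g f \<in> Hom ?C a c"
      using implicative_compose[of a b c f g] obj by simp
    show "\<lbrakk>a \<in> Obj ?C; b \<in> Obj ?C; f \<in> Hom ?C a b\<rbrakk> \<Longrightarrow> Comp ?C a b b (Ident ?C b) f = f"
      using hom[of f a b] by (simp add: identity_morphism_def Id_compose)
    show "\<lbrakk>a \<in> Obj ?C; b \<in> Obj ?C; f \<in> Hom ?C a b\<rbrakk> \<Longrightarrow> Comp ?C a a b f (Ident ?C a) = f"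
      using hom[of f a b] by (simp add: identity_morphism_def compose_Id)
    show "\<lbrakk>a \<in> Obj ?C; b \<in> Obj ?C; c \<in> Obj ?C; d \<in> Obj ?C;
        f \<in> Hom ?C a b; g \<in> Hom ?C b c; h \<in> Hom ?C c d\<rbrakk>
        \<Longrightarrow> Comp ?C a c d h (Comp ?C a b c g f) = Comp ?C a b d (Comp ?C b c d h g) f"
      using hom(2)[of f a b] by (simp add: compose_assoc)
    show "\<lbrakk>a \<in> Obj ?C; b \<in> Obj ?C; f \<in> Hom ?C a b\<rbrakk> \<Longrightarrow> Leq ?C a b f f"
      using hom(2)[of f a b] by (simp add: morphism_le_refl obj)
    show "\<lbrakk>a \<in> Obj ?C; b \<in> Obj ?C; f \<in> Hom ?C a b; g \<in> Hom ?C a b; h \<in> Hom ?C a b;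
        Leq ?C a b f g; Leq ?C a b g h\<rbrakk> \<Longrightarrow> Leq ?C a b f h"
      using hom(2)[of _ a b] morphism_le_trans[of b f a g h] obj by simp
    show "\<lbrakk>a \<in> Obj ?C; b \<in> Obj ?C; c \<in> Obj ?C;
        f \<in> Hom ?C a b; f' \<in> Hom ?C a b; g \<in> Hom ?C b c; g' \<in> Hom ?C b c;
        Leq ?C a b f f'; Leq ?C b c g g'\<rbrakk>
        \<Longrightarrow> Leq ?C a c (Comp ?C a b c g f) (Comp ?C a b c g' f')"
      using hom(2)[of _ a b] hom(2)[of _ b c] morphism_le_compose[of b c f a f' g g'] obj by simp
  qed
qed

section \<open>Monotone hulls\<close>

text \<open>The monotone hull is the meet of the values of \<open>f\<close> above the argument. Each value is
  wrapped in \<open>del B\<close> so that the entries are implications, as \<open>realized_imp_inf\<close> requires.\<close>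

definition monotone_hull ::
    "'a arrow_structure \<Rightarrow> 'b arrow_structure \<Rightarrow> ('a \<Rightarrow> 'b) \<Rightarrow> 'a \<Rightarrow> 'b" where
  "monotone_hull A B f =
     (\<lambda>x\<in>carrier A. \<Sqinter>\<^bsub>B\<^esub> {del B (f a) | a. a \<in> carrier A \<and> x \<sqsubseteq>\<^bsub>A\<^esub> a})"

context implicative
begin

lemma hull_subset: "{del B (f a) | a. a \<in> carrier A \<and> x \<sqsubseteq>\<^bsub>A\<^esub> a} \<subseteq> carrier B"
  by auto

lemma hull_extensional_funcset: "monotone_hull A B f \<in> carrier A \<rightarrow>\<^sub>E carrier B"
  unfolding monotone_hull_def using hull_subset by (auto intro!: B.inf_closed)

lemma hull_closed [simp]: "a \<in> carrier A \<Longrightarrow> monotone_hull A B f a \<in> carrier B"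
  using hull_extensional_funcset by auto

lemma hull_mono:
  assumes "x \<in> carrier A" "y \<in> carrier A" "x \<sqsubseteq>\<^bsub>A\<^esub> y"
  shows "monotone_hull A B f x \<sqsubseteq>\<^bsub>B\<^esub> monotone_hull A B f y"
proof -
  have sub: "{del B (f a) | a. a \<in> carrier A \<and> y \<sqsubseteq>\<^bsub>A\<^esub> a} \<subseteq> {del B (f a) | a. a \<in> carrier A \<and> x \<sqsubseteq>\<^bsub>A\<^esub> a}"
    using assms A.le_trans by blast
  have "\<Sqinter>\<^bsub>B\<^esub> {del B (f a) | a. a \<in> carrier A \<and> x \<sqsubseteq>\<^bsub>A\<^esub> a}
      \<sqsubseteq>\<^bsub>B\<^esub> \<Sqinter>\<^bsub>B\<^esub> {del B (f a) | a. a \<in> carrier A \<and> y \<sqsubseteq>\<^bsub>A\<^esub> a}"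
    by (intro B.inf_greatest B.inf_lower B.inf_closed hull_subset subsetD[OF sub])
  then show ?thesis
    using assms by (simp add: monotone_hull_def)
qed

text \<open>The argument itself is among the elements above it, so the hull is below \<open>del B (f x)\<close>.
  Conversely, \<open>x \<sqsubseteq> a\<close> makes \<open>x \<leadsto> a\<close> realized uniformly in \<open>x\<close> and \<open>a\<close>; hence so is
  \<open>f x \<leadsto> f a\<close>, and \<open>realized_imp_inf\<close> collects these for fixed \<open>x\<close>.\<close>

lemma hull_iso: "morphism_iso A B f (monotone_hull A B f)"
proof -
  let ?F = "monotone_hull A B f"
  have Fc: "?F \<in> carrier A \<rightarrow> carrier B" by simp
  have "realized B (carrier A) (\<lambda>x. ?F x \<leadsto>\<^bsub>B\<^esub> del B (f x))"
  proof (rule B.realized_le)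
    fix x assume "x \<in> carrier A"
    then show "?F x \<sqsubseteq>\<^bsub>B\<^esub> del B (f x)"
      unfolding monotone_hull_def using hull_subset by (auto intro!: B.inf_lower)
  qed auto
  then have 1: "realized B (carrier A) (\<lambda>x. ?F x \<leadsto>\<^bsub>B\<^esub> f x)"
    by (rule B.realized_trans[OF _ B.realized_del_elim]) auto
  let ?J = "\<lambda>x. {a \<in> carrier A. x \<sqsubseteq>\<^bsub>A\<^esub> a}"
  have "realized A (Sigma (carrier A) ?J) (\<lambda>p. fst p \<leadsto>\<^bsub>A\<^esub> snd p)"
    by (rule A.realized_le) auto
  then have "realized B (Sigma (carrier A) ?J) (\<lambda>p. f (fst p) \<leadsto>\<^bsub>B\<^esub> f (snd p))"
    by (rule realized_map) auto
  then have "realized B (Sigma (carrier A) ?J) (\<lambda>p. f (fst p) \<leadsto>\<^bsub>B\<^esub> del B (f (snd p)))"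
    by (rule B.realized_trans[OF _ B.realized_del_intro]) auto
  then have "realized B (Sigma (carrier A) ?J) (\<lambda>(x, a). f x \<leadsto>\<^bsub>B\<^esub> \<top>\<^bsub>B\<^esub> \<leadsto>\<^bsub>B\<^esub> f a)"
    by (simp add: del_def case_prod_unfold)
  then have "realized B (carrier A) (\<lambda>x. f x \<leadsto>\<^bsub>B\<^esub> \<Sqinter>\<^bsub>B\<^esub> ((\<lambda>a. \<top>\<^bsub>B\<^esub> \<leadsto>\<^bsub>B\<^esub> f a) ` ?J x))"
    by (rule B.realized_imp_inf) auto
  then have 2: "realized B (carrier A) (\<lambda>x. f x \<leadsto>\<^bsub>B\<^esub> ?F x)"
    by (subst realized_cong[where \<psi> = "\<lambda>x. f x \<leadsto>\<^bsub>B\<^esub> \<Sqinter>\<^bsub>B\<^esub> ((\<lambda>a. \<top>\<^bsub>B\<^esub> \<leadsto>\<^bsub>B\<^esub> f a) ` ?J x)"])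
      (simp_all add: monotone_hull_def del_def setcompr_eq_image)
  show ?thesis
    using 1 2 morphism_le_iff_realized[OF B.arrow_algebra_axioms funcset Fc]
      morphism_le_iff_realized[OF B.arrow_algebra_axioms Fc funcset]
    by (simp add: morphism_iso_def)
qed

lemma implicative_hull: "implicative_morphism A B (monotone_hull A B f)"
  by (rule implicative_iso[OF A.arrow_algebra_axioms B.arrow_algebra_axioms implicative
        hull_extensional_funcset hull_iso])

end

section \<open>The Sierpinski construction on objects\<close>

lemma carrier_sierpinski:
  "x \<in> carrier (sierpinski A) \<longleftrightarrow> fst x \<in> carrier A \<and> snd x \<in> carrier A \<and> fst x \<sqsubseteq>\<^bsub>A\<^esub> snd x"
  by (auto simp: sierpinski_def)

lemma le_sierpinski: "x \<sqsubseteq>\<^bsub>sierpinski A\<^esub> y \<longleftrightarrow> fst x \<sqsubseteq>\<^bsub>A\<^esub> fst y \<and> snd x \<sqsubseteq>\<^bsub>A\<^esub> snd y"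
  by (auto simp: sierpinski_def)

lemma imp_sierpinski:
  "x \<leadsto>\<^bsub>sierpinski A\<^esub> y =
     ((fst x \<leadsto>\<^bsub>A\<^esub> fst y) \<sqinter>\<^bsub>A\<^esub> (snd x \<leadsto>\<^bsub>A\<^esub> snd y), snd x \<leadsto>\<^bsub>A\<^esub> snd y)"
  by (auto simp: sierpinski_def case_prod_unfold)

lemma separator_sierpinski:
  "x \<in> separator (sierpinski A) \<longleftrightarrow> x \<in> carrier (sierpinski A) \<and> fst x \<in> separator A"
  by (auto simp: sierpinski_def)

context arrow_algebra
begin

text \<open>\<open>comb_s\<close> is still a lower bound when its two hypotheses are strengthened. The components
  of a Sierpinski implication have this shape.\<close>

lemma comb_s_le_imp:
  assumes "p \<sqsubseteq> a \<leadsto> b \<leadsto> d" "q \<sqsubseteq> a \<leadsto> b"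
    and "p \<in> carrier A" "q \<in> carrier A" "a \<in> carrier A" "b \<in> carrier A" "d \<in> carrier A"
  shows "comb_s A \<sqsubseteq> p \<leadsto> q \<leadsto> a \<leadsto> d"
proof (rule le_trans[OF comb_s_le[of a b d]])
  show "(a \<leadsto> b \<leadsto> d) \<leadsto> (a \<leadsto> b) \<leadsto> a \<leadsto> d \<sqsubseteq> p \<leadsto> q \<leadsto> a \<leadsto> d"
    using assms by (intro imp_mono imp_antitone) auto
qed (use assms separator_s separator_carrier in auto)

text \<open>Likewise for \<open>comb_a\<close>. The meets are described by what they are below and above, since the
  meets arising in the Sierpinski algebra are not literally those of \<open>comb_a_entry\<close>.\<close>

lemma comb_a_le_imp:
  assumes cl: "p \<in> carrier A" "a \<in> carrier A" "r \<in> carrier A" "Z \<subseteq> carrier A \<times> carrier A"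
    and p: "\<And>b c. (b, c) \<in> Z \<Longrightarrow> p \<sqsubseteq> a \<leadsto> b \<leadsto> c"
    and r: "\<And>q. \<lbrakk>q \<in> carrier A; \<And>b c. (b, c) \<in> Z \<Longrightarrow> q \<sqsubseteq> b \<leadsto> c\<rbrakk> \<Longrightarrow> q \<sqsubseteq> r"
  shows "comb_a A \<sqsubseteq> p \<leadsto> a \<leadsto> r"
proof -
  let ?P = "\<Sqinter> {a \<leadsto> b \<leadsto> c | b c. (b, c) \<in> Z}"
  let ?Q = "\<Sqinter> {b \<leadsto> c | b c. (b, c) \<in> Z}"
  have sub: "{a \<leadsto> b \<leadsto> c | b c. (b, c) \<in> Z} \<subseteq> carrier A" "{b \<leadsto> c | b c. (b, c) \<in> Z} \<subseteq> carrier A"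
    using cl by auto
  have "p \<sqsubseteq> ?P"
    by (rule inf_greatest[OF sub(1)]) (use p cl in auto)
  moreover have "?Q \<sqsubseteq> r"
  proof (rule r)
    show "?Q \<sqsubseteq> b \<leadsto> c" if "(b, c) \<in> Z" for b c
      by (rule inf_lower[OF sub(2)]) (use that in blast)
  qed (use sub in simp)
  ultimately have "?P \<leadsto> a \<leadsto> ?Q \<sqsubseteq> p \<leadsto> a \<leadsto> r"
    using cl sub by (intro imp_mono imp_monotone) auto
  moreover have "comb_a A \<sqsubseteq> ?P \<leadsto> a \<leadsto> ?Q"
    using comb_a_le[OF cl(2,4)] unfolding comb_a_entry_def .
  ultimately show ?thesis
    using le_trans cl sub separator_a separator_carrier by (meson imp_closed inf_closed)
qed

lemma partial_order_sierpinski: "partial_order (sierpinski A)"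
proof unfold_locales
  show "(.=\<^bsub>sierpinski A\<^esub>) = (=)" by (simp add: sierpinski_def)
  then show "x .=\<^bsub>sierpinski A\<^esub> x" "x .=\<^bsub>sierpinski A\<^esub> y \<Longrightarrow> y .=\<^bsub>sierpinski A\<^esub> x"
    "x .=\<^bsub>sierpinski A\<^esub> y \<Longrightarrow> y .=\<^bsub>sierpinski A\<^esub> z \<Longrightarrow> x .=\<^bsub>sierpinski A\<^esub> z"
    "\<lbrakk>x .=\<^bsub>sierpinski A\<^esub> y; z .=\<^bsub>sierpinski A\<^esub> w\<rbrakk> \<Longrightarrow> x \<sqsubseteq>\<^bsub>sierpinski A\<^esub> z \<longleftrightarrow> y \<sqsubseteq>\<^bsub>sierpinski A\<^esub> w"
    "\<lbrakk>x \<sqsubseteq>\<^bsub>sierpinski A\<^esub> y; y \<sqsubseteq>\<^bsub>sierpinski A\<^esub> x; x \<in> carrier (sierpinski A); y \<in> carrier (sierpinski A)\<rbrakk>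
      \<Longrightarrow> x .=\<^bsub>sierpinski A\<^esub> y" for x y z w
    by (auto simp: le_sierpinski carrier_sierpinski le_antisym prod_eq_iff)
  show "x \<in> carrier (sierpinski A) \<Longrightarrow> x \<sqsubseteq>\<^bsub>sierpinski A\<^esub> x" for x
    by (simp add: le_sierpinski carrier_sierpinski)
  show "\<lbrakk>x \<sqsubseteq>\<^bsub>sierpinski A\<^esub> y; y \<sqsubseteq>\<^bsub>sierpinski A\<^esub> z; x \<in> carrier (sierpinski A);
      y \<in> carrier (sierpinski A); z \<in> carrier (sierpinski A)\<rbrakk> \<Longrightarrow> x \<sqsubseteq>\<^bsub>sierpinski A\<^esub> z" for x y z
    using le_trans by (auto simp: le_sierpinski carrier_sierpinski)
qed

lemma sierpinski_components:
  assumes "X \<subseteq> carrier (sierpinski A)"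
  shows "fst ` X \<subseteq> carrier A" "snd ` X \<subseteq> carrier A"
  using assms by (auto simp: carrier_sierpinski)

lemma greatest_sierpinski:
  assumes X: "X \<subseteq> carrier (sierpinski A)"
  shows "greatest (sierpinski A) (\<Sqinter> (fst ` X), \<Sqinter> (snd ` X)) (Lower (sierpinski A) X)"
proof (rule greatest_LowerI)
  note sub = sierpinski_components[OF X]
  have "\<Sqinter> (fst ` X) \<sqsubseteq> snd x" if "x \<in> X" for x
  proof (rule le_trans)
    show "\<Sqinter> (fst ` X) \<sqsubseteq> fst x" using that sub by (intro inf_lower) auto
    show "fst x \<sqsubseteq> snd x" using that X by (auto simp: carrier_sierpinski)
  qed (use that sub in auto)
  then have le: "\<Sqinter> (fst ` X) \<sqsubseteq> \<Sqinter> (snd ` X)"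
    using sub by (intro inf_greatest) auto
  then show "(\<Sqinter> (fst ` X), \<Sqinter> (snd ` X)) \<in> carrier (sierpinski A)"
    using sub by (simp add: carrier_sierpinski)
  show "(\<Sqinter> (fst ` X), \<Sqinter> (snd ` X)) \<sqsubseteq>\<^bsub>sierpinski A\<^esub> x" if "x \<in> X" for x
    using that sub by (auto simp: le_sierpinski intro!: inf_lower)
  show "y \<sqsubseteq>\<^bsub>sierpinski A\<^esub> (\<Sqinter> (fst ` X), \<Sqinter> (snd ` X))" if "y \<in> Lower (sierpinski A) X" for y
  proof -
    have "y \<in> carrier (sierpinski A)" "x \<in> X \<Longrightarrow> y \<sqsubseteq>\<^bsub>sierpinski A\<^esub> x" for x
      using that X unfolding Lower_def by blast+
    then show ?thesis
      using sub by (auto simp: le_sierpinski carrier_sierpinski intro!: inf_greatest)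
  qed
qed (rule X)

lemma inf_sierpinski:
  assumes "X \<subseteq> carrier (sierpinski A)"
  shows "\<Sqinter>\<^bsub>sierpinski A\<^esub> X = (\<Sqinter> (fst ` X), \<Sqinter> (snd ` X))"
proof -
  interpret S: partial_order "sierpinski A" by (rule partial_order_sierpinski)
  show ?thesis
    unfolding inf_def[of "sierpinski A"]
    using greatest_sierpinski[OF assms] S.greatest_unique by (intro some_equality) auto
qed

lemma inf_sierpinski_in_separator:
  assumes "X \<subseteq> carrier (sierpinski A)" "s \<in> separator A" "\<And>x. x \<in> X \<Longrightarrow> s \<sqsubseteq> fst x"
  shows "\<Sqinter>\<^bsub>sierpinski A\<^esub> X \<in> separator (sierpinski A)"
proof -
  have "\<Sqinter> (fst ` X) \<in> separator A"
    using inf_in_separator_iff[OF sierpinski_components(1)[OF assms(1)]] assms(2,3) by blast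
  then show ?thesis
    using greatest_closed[OF greatest_sierpinski[OF assms(1)]]
    by (simp add: separator_sierpinski inf_sierpinski assms(1))
qed

lemma imp_sierpinski_closed:
  assumes "x \<in> carrier (sierpinski A)" "y \<in> carrier (sierpinski A)"
  shows "x \<leadsto>\<^bsub>sierpinski A\<^esub> y \<in> carrier (sierpinski A)"
  using assms by (simp add: imp_sierpinski carrier_sierpinski meet_right)

lemma meet_sierpinski:
  assumes "x \<in> carrier (sierpinski A)" "y \<in> carrier (sierpinski A)"
  shows "x \<sqinter>\<^bsub>sierpinski A\<^esub> y = (fst x \<sqinter> fst y, snd x \<sqinter> snd y)"
  using inf_sierpinski[of "{x, y}"] assms by (simp add: meet_def)

lemma sierpinski_closed [simp]:
  assumes "x \<in> carrier (sierpinski A)"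
  shows "fst x \<in> carrier A" "snd x \<in> carrier A" "fst x \<sqsubseteq> snd x"
  using assms by (simp_all add: carrier_sierpinski)

lemma snd_imp_sierpinski: "snd (x \<leadsto>\<^bsub>sierpinski A\<^esub> y) = snd x \<leadsto> snd y"
  by (simp add: imp_sierpinski)

lemma le_imp_sierpinski_iff:
  assumes "s \<in> carrier A" "x \<in> carrier (sierpinski A)" "y \<in> carrier (sierpinski A)"
  shows "s \<sqsubseteq> fst (x \<leadsto>\<^bsub>sierpinski A\<^esub> y) \<longleftrightarrow> s \<sqsubseteq> fst x \<leadsto> fst y \<and> s \<sqsubseteq> snd x \<leadsto> snd y"
  using assms by (simp add: imp_sierpinski le_meet_iff)

lemma imp_sierpinski_le:
  assumes "x \<in> carrier (sierpinski A)" "y \<in> carrier (sierpinski A)"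
  shows "fst (x \<leadsto>\<^bsub>sierpinski A\<^esub> y) \<sqsubseteq> fst x \<leadsto> fst y" "fst (x \<leadsto>\<^bsub>sierpinski A\<^esub> y) \<sqsubseteq> snd x \<leadsto> snd y"
  using assms by (simp_all add: imp_sierpinski meet_left meet_right)

end

locale bi_arrow_algebra = arrow_algebra A for A :: "'a arrow_structure" (structure) +
  assumes imp_meet:
    "\<lbrakk>a \<in> carrier A; b \<in> carrier A; c \<in> carrier A\<rbrakk> \<Longrightarrow> a \<leadsto> (b \<sqinter> c) = (a \<leadsto> b) \<sqinter> (a \<leadsto> c)"

lemma binary_implicative_iff: "binary_implicative A \<longleftrightarrow> bi_arrow_algebra A"
  by (auto simp: binary_implicative_def bi_arrow_algebra_def bi_arrow_algebra_axioms_def)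

context bi_arrow_algebra
begin

text \<open>Under further hypotheses, distributivity is what splits the first component of an
  implication into its two halves.\<close>

lemma le_imp_imp_sierpinski_iff:
  assumes "s \<in> carrier A" "a \<in> carrier A" "x \<in> carrier (sierpinski A)" "y \<in> carrier (sierpinski A)"
  shows "s \<sqsubseteq> a \<leadsto> fst (x \<leadsto>\<^bsub>sierpinski A\<^esub> y) \<longleftrightarrow>
    s \<sqsubseteq> a \<leadsto> fst x \<leadsto> fst y \<and> s \<sqsubseteq> a \<leadsto> snd x \<leadsto> snd y"
  using assms by (simp add: imp_sierpinski imp_meet le_meet_iff)

lemma le_imp_imp_imp_sierpinski_iff:
  assumes "s \<in> carrier A" "a \<in> carrier A" "b \<in> carrier A"
    "x \<in> carrier (sierpinski A)" "y \<in> carrier (sierpinski A)"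
  shows "s \<sqsubseteq> a \<leadsto> b \<leadsto> fst (x \<leadsto>\<^bsub>sierpinski A\<^esub> y) \<longleftrightarrow>
    s \<sqsubseteq> a \<leadsto> b \<leadsto> fst x \<leadsto> fst y \<and> s \<sqsubseteq> a \<leadsto> b \<leadsto> snd x \<leadsto> snd y"
  using assms by (simp add: imp_sierpinski imp_meet le_meet_iff)

lemmas comb_closed [simp] = separator_k[THEN separator_carrier] separator_s[THEN separator_carrier]
  separator_a[THEN separator_carrier]

text \<open>For each combinator, the first component of an instance in the Sierpinski algebra splits into
  instances for \<open>A\<close>, weakened by \<open>fst z \<sqsubseteq> snd z\<close>; so the combinator of \<open>A\<close> bounds
  it from below.\<close>

lemma comb_k_le_sierpinski:
  assumes xy: "x \<in> carrier (sierpinski A)" "y \<in> carrier (sierpinski A)"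
  shows "comb_k A \<sqsubseteq> fst (x \<leadsto>\<^bsub>sierpinski A\<^esub> y \<leadsto>\<^bsub>sierpinski A\<^esub> x)"
proof -
  have "snd x \<leadsto> snd y \<leadsto> snd x \<sqsubseteq> fst x \<leadsto> snd y \<leadsto> snd x"
    by (rule imp_antitone) (use xy in simp_all)
  from le_trans[OF comb_k_le this] have "comb_k A \<sqsubseteq> fst x \<leadsto> snd y \<leadsto> snd x"
    using xy by simp
  then show ?thesis
    using xy by (simp add: le_imp_sierpinski_iff le_imp_imp_sierpinski_iff snd_imp_sierpinski
        imp_sierpinski_closed comb_k_le)
qed

lemma comb_s_le_sierpinski:
  assumes xyz: "x \<in> carrier (sierpinski A)" "y \<in> carrier (sierpinski A)" "z \<in> carrier (sierpinski A)"
  shows "comb_s A \<sqsubseteq> fst ((x \<leadsto>\<^bsub>sierpinski A\<^esub> y \<leadsto>\<^bsub>sierpinski A\<^esub> z) \<leadsto>\<^bsub>sierpinski A\<^esub>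
    (x \<leadsto>\<^bsub>sierpinski A\<^esub> y) \<leadsto>\<^bsub>sierpinski A\<^esub> x \<leadsto>\<^bsub>sierpinski A\<^esub> z)"
proof -
  note [simp] = imp_sierpinski_closed
  let ?p = "fst (x \<leadsto>\<^bsub>sierpinski A\<^esub> y \<leadsto>\<^bsub>sierpinski A\<^esub> z)" and ?q = "fst (x \<leadsto>\<^bsub>sierpinski A\<^esub> y)"
  have "?p \<sqsubseteq> ?p" using xyz by simp
  then have p: "?p \<sqsubseteq> fst x \<leadsto> fst y \<leadsto> fst z" "?p \<sqsubseteq> snd x \<leadsto> snd y \<leadsto> snd z"
    using xyz le_imp_sierpinski_iff[of ?p x "y \<leadsto>\<^bsub>sierpinski A\<^esub> z"]
      le_imp_imp_sierpinski_iff[of ?p "fst x" y z]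
    by (simp_all add: snd_imp_sierpinski)
  note q = imp_sierpinski_le[OF xyz(1,2)]
  have "comb_s A \<sqsubseteq> ?p \<leadsto> ?q \<leadsto> fst x \<leadsto> fst z"
    by (rule comb_s_le_imp[OF p(1) q(1)]) (use xyz in simp_all)
  moreover have "comb_s A \<sqsubseteq> ?p \<leadsto> ?q \<leadsto> snd x \<leadsto> snd z"
    by (rule comb_s_le_imp[OF p(2) q(2)]) (use xyz in simp_all)
  moreover have "comb_s A \<sqsubseteq> ?p \<leadsto> (snd x \<leadsto> snd y) \<leadsto> snd x \<leadsto> snd z"
    by (rule comb_s_le_imp[OF p(2)]) (use xyz in simp_all)
  ultimately show ?thesis
    using xyz by (simp add: le_imp_sierpinski_iff le_imp_imp_sierpinski_iff
        le_imp_imp_imp_sierpinski_iff snd_imp_sierpinski comb_s_le)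
qed

text \<open>Here the first component of the goal contains a meet over both halves of every pair in
  \<open>Y\<close>. It is bounded by the entry of \<open>comb_a A\<close> at the union of the two component families.\<close>

lemma comb_a_le_sierpinski:
  assumes x: "x \<in> carrier (sierpinski A)" and Y: "Y \<subseteq> carrier (sierpinski A) \<times> carrier (sierpinski A)"
  shows "comb_a A \<sqsubseteq> fst (comb_a_entry (sierpinski A) x Y)"
    and "comb_a_entry (sierpinski A) x Y \<in> carrier (sierpinski A)"
proof -
  note [simp] = imp_sierpinski_closed
  let ?L = "{x \<leadsto>\<^bsub>sierpinski A\<^esub> b \<leadsto>\<^bsub>sierpinski A\<^esub> c | b c. (b, c) \<in> Y}"
  let ?R = "{b \<leadsto>\<^bsub>sierpinski A\<^esub> c | b c. (b, c) \<in> Y}"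
  define l where "l = \<Sqinter>\<^bsub>sierpinski A\<^esub> ?L"
  define r where "r = \<Sqinter>\<^bsub>sierpinski A\<^esub> ?R"
  have sub: "?L \<subseteq> carrier (sierpinski A)" "?R \<subseteq> carrier (sierpinski A)"
    using x Y by auto
  have lr [simp]: "l \<in> carrier (sierpinski A)" "r \<in> carrier (sierpinski A)"
    unfolding l_def r_def inf_sierpinski[OF sub(1)] inf_sierpinski[OF sub(2)]
    by (rule greatest_closed, rule greatest_sierpinski, rule sub)+
  have Yc [simp]: "b \<in> carrier (sierpinski A)" "c \<in> carrier (sierpinski A)" if "(b, c) \<in> Y" for b c
    using that Y by auto
  have l: "fst l \<sqsubseteq> fst x \<leadsto> fst b \<leadsto> fst c" "fst l \<sqsubseteq> fst x \<leadsto> snd b \<leadsto> snd c"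
    "fst l \<sqsubseteq> snd x \<leadsto> snd b \<leadsto> snd c" "snd l \<sqsubseteq> snd x \<leadsto> snd b \<leadsto> snd c" if bc: "(b, c) \<in> Y" for b c
  proof -
    have "x \<leadsto>\<^bsub>sierpinski A\<^esub> b \<leadsto>\<^bsub>sierpinski A\<^esub> c \<in> ?L" using bc by blast
    then have "l \<sqsubseteq>\<^bsub>sierpinski A\<^esub> x \<leadsto>\<^bsub>sierpinski A\<^esub> b \<leadsto>\<^bsub>sierpinski A\<^esub> c"
      unfolding l_def inf_sierpinski[OF sub(1)]
      by (rule greatest_Lower_below[OF greatest_sierpinski[OF sub(1)] _ sub(1)])
    then show "fst l \<sqsubseteq> fst x \<leadsto> fst b \<leadsto> fst c" "fst l \<sqsubseteq> fst x \<leadsto> snd b \<leadsto> snd c"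
      "fst l \<sqsubseteq> snd x \<leadsto> snd b \<leadsto> snd c" "snd l \<sqsubseteq> snd x \<leadsto> snd b \<leadsto> snd c"
      using bc x by (simp_all add: le_sierpinski le_imp_sierpinski_iff le_imp_imp_sierpinski_iff
          snd_imp_sierpinski)
  qed
  have r0: "q \<sqsubseteq> fst r" if "q \<in> carrier A"
    "\<And>b c. (b, c) \<in> Y \<Longrightarrow> q \<sqsubseteq> fst b \<leadsto> fst c" "\<And>b c. (b, c) \<in> Y \<Longrightarrow> q \<sqsubseteq> snd b \<leadsto> snd c" for q
    unfolding r_def inf_sierpinski[OF sub(2)] fst_conv
    by (rule inf_greatest[OF sierpinski_components(1)[OF sub(2)]])
      (use that in \<open>auto simp: le_imp_sierpinski_iff\<close>)
  have r1: "q \<sqsubseteq> snd r" if "q \<in> carrier A" "\<And>b c. (b, c) \<in> Y \<Longrightarrow> q \<sqsubseteq> snd b \<leadsto> snd c" for q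
    unfolding r_def inf_sierpinski[OF sub(2)] snd_conv
    by (rule inf_greatest[OF sierpinski_components(2)[OF sub(2)]])
      (use that in \<open>auto simp: snd_imp_sierpinski\<close>)
  let ?Z0 = "{(fst b, fst c) | b c. (b, c) \<in> Y}" and ?Z1 = "{(snd b, snd c) | b c. (b, c) \<in> Y}"
  have Z: "?Z0 \<subseteq> carrier A \<times> carrier A" "?Z1 \<subseteq> carrier A \<times> carrier A"
    using Yc sierpinski_closed by blast+
  have "comb_a A \<sqsubseteq> fst l \<leadsto> fst x \<leadsto> fst r"
  proof (rule comb_a_le_imp)
    show "?Z0 \<union> ?Z1 \<subseteq> carrier A \<times> carrier A" using Z by blast
    show "fst l \<sqsubseteq> fst x \<leadsto> b \<leadsto> c" if "(b, c) \<in> ?Z0 \<union> ?Z1" for b c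
      using that l by blast
    show "q \<sqsubseteq> fst r" if "q \<in> carrier A" "\<And>b c. (b, c) \<in> ?Z0 \<union> ?Z1 \<Longrightarrow> q \<sqsubseteq> b \<leadsto> c" for q
      by (rule r0[OF that(1)]; rule that(2); blast)
  qed (use x in simp_all)
  moreover have "comb_a A \<sqsubseteq> fst l \<leadsto> snd x \<leadsto> snd r"
  proof (rule comb_a_le_imp)
    show "?Z1 \<subseteq> carrier A \<times> carrier A" using Z by blast
    show "fst l \<sqsubseteq> snd x \<leadsto> b \<leadsto> c" if "(b, c) \<in> ?Z1" for b c
      using that l by blast
    show "q \<sqsubseteq> snd r" if "q \<in> carrier A" "\<And>b c. (b, c) \<in> ?Z1 \<Longrightarrow> q \<sqsubseteq> b \<leadsto> c" for q
      by (rule r1[OF that(1)]; rule that(2); blast)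
  qed (use x in simp_all)
  moreover have "comb_a A \<sqsubseteq> snd l \<leadsto> snd x \<leadsto> snd r"
  proof (rule comb_a_le_imp)
    show "?Z1 \<subseteq> carrier A \<times> carrier A" using Z by blast
    show "snd l \<sqsubseteq> snd x \<leadsto> b \<leadsto> c" if "(b, c) \<in> ?Z1" for b c
      using that l by blast
    show "q \<sqsubseteq> snd r" if "q \<in> carrier A" "\<And>b c. (b, c) \<in> ?Z1 \<Longrightarrow> q \<sqsubseteq> b \<leadsto> c" for q
      by (rule r1[OF that(1)]; rule that(2); blast)
  qed (use x in simp_all)
  ultimately show "comb_a A \<sqsubseteq> fst (comb_a_entry (sierpinski A) x Y)"
    unfolding comb_a_entry_def l_def[symmetric] r_def[symmetric]
    using x by (simp add: le_imp_sierpinski_iff le_imp_imp_sierpinski_iff snd_imp_sierpinski)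
  show "comb_a_entry (sierpinski A) x Y \<in> carrier (sierpinski A)"
    unfolding comb_a_entry_def l_def[symmetric] r_def[symmetric] using x by simp
qed

lemma imp_sierpinski_mono:
  assumes "x' \<sqsubseteq>\<^bsub>sierpinski A\<^esub> x" "y \<sqsubseteq>\<^bsub>sierpinski A\<^esub> y'"
    and c: "x \<in> carrier (sierpinski A)" "x' \<in> carrier (sierpinski A)"
      "y \<in> carrier (sierpinski A)" "y' \<in> carrier (sierpinski A)"
  shows "x \<leadsto>\<^bsub>sierpinski A\<^esub> y \<sqsubseteq>\<^bsub>sierpinski A\<^esub> x' \<leadsto>\<^bsub>sierpinski A\<^esub> y'"
proof -
  let ?m = "fst (x \<leadsto>\<^bsub>sierpinski A\<^esub> y)"
  have m: "?m \<in> carrier A" using c by (simp add: imp_sierpinski_closed)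
  have 0: "fst x \<leadsto> fst y \<sqsubseteq> fst x' \<leadsto> fst y'" and 1: "snd x \<leadsto> snd y \<sqsubseteq> snd x' \<leadsto> snd y'"
    using assms by (auto simp: le_sierpinski intro!: imp_mono)
  have "?m \<sqsubseteq> fst x' \<leadsto> fst y'" "?m \<sqsubseteq> snd x' \<leadsto> snd y'"
    using le_trans[OF imp_sierpinski_le(1) 0] le_trans[OF imp_sierpinski_le(2) 1] m c by simp_all
  then show ?thesis
    using m c 1 by (simp add: le_sierpinski snd_imp_sierpinski le_imp_sierpinski_iff)
qed

lemma arrow_algebra_sierpinski: "arrow_algebra (sierpinski A)"
proof -
  interpret S: partial_order "sierpinski A" by (rule partial_order_sierpinski)
  note [simp] = imp_sierpinski_closed
  show ?thesis
  proof unfold_locales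
    show "\<exists>m. greatest (sierpinski A) m (Lower (sierpinski A) X)" if "X \<subseteq> carrier (sierpinski A)" for X
      using greatest_sierpinski[OF that] by blast
    show "separator (sierpinski A) \<subseteq> carrier (sierpinski A)"
      by (auto simp: separator_sierpinski)
    show "y \<in> separator (sierpinski A)"
      if "x \<in> separator (sierpinski A)" "y \<in> carrier (sierpinski A)" "x \<sqsubseteq>\<^bsub>sierpinski A\<^esub> y" for x y
      using that separator_upward by (auto simp: separator_sierpinski le_sierpinski)
    show "y \<in> separator (sierpinski A)"
      if c: "x \<in> carrier (sierpinski A)" "y \<in> carrier (sierpinski A)"
        and "x \<leadsto>\<^bsub>sierpinski A\<^esub> y \<in> separator (sierpinski A)" "x \<in> separator (sierpinski A)" for x y
    proof -
      have "fst x \<leadsto> fst y \<in> separator A"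
        using separator_upward[OF _ _ imp_sierpinski_le(1)[OF c]] that by (simp add: separator_sierpinski)
      then show ?thesis
        using separator_mp[of "fst x" "fst y"] that by (simp add: separator_sierpinski)
    qed
    show "comb_k (sierpinski A) \<in> separator (sierpinski A)"
      unfolding comb_k_def
      by (rule inf_sierpinski_in_separator[OF _ separator_k]) (auto simp: comb_k_le_sierpinski)
    show "comb_s (sierpinski A) \<in> separator (sierpinski A)"
      unfolding comb_s_def
      by (rule inf_sierpinski_in_separator[OF _ separator_s]) (auto simp: comb_s_le_sierpinski)
    show "comb_a (sierpinski A) \<in> separator (sierpinski A)"
      unfolding comb_a_def
      by (rule inf_sierpinski_in_separator[OF _ separator_a]) (use comb_a_le_sierpinski in auto)
  qed (auto intro: imp_sierpinski_mono)
qed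

lemma bi_arrow_algebra_sierpinski: "bi_arrow_algebra (sierpinski A)"
proof (intro bi_arrow_algebra.intro bi_arrow_algebra_axioms.intro arrow_algebra_sierpinski)
  interpret S: arrow_algebra "sierpinski A" by (rule arrow_algebra_sierpinski)
  fix x y z
  assume c: "x \<in> carrier (sierpinski A)" "y \<in> carrier (sierpinski A)" "z \<in> carrier (sierpinski A)"
  have yz: "y \<sqinter>\<^bsub>sierpinski A\<^esub> z \<in> carrier (sierpinski A)" using c by simp
  have "(a \<sqinter> b) \<sqinter> (d \<sqinter> e) = (a \<sqinter> d) \<sqinter> (b \<sqinter> e)"
    if "a \<in> carrier A" "b \<in> carrier A" "d \<in> carrier A" "e \<in> carrier A" for a b d e
    using that by (metis meet_assoc meet_closed meet_comm)
  then show "x \<leadsto>\<^bsub>sierpinski A\<^esub> (y \<sqinter>\<^bsub>sierpinski A\<^esub> z)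
      = (x \<leadsto>\<^bsub>sierpinski A\<^esub> y) \<sqinter>\<^bsub>sierpinski A\<^esub> (x \<leadsto>\<^bsub>sierpinski A\<^esub> z)"
    using c by (simp add: meet_sierpinski imp_sierpinski_closed) (simp add: imp_sierpinski imp_meet)
qed

end

section \<open>The Sierpinski construction on morphisms\<close>

definition monotone_implicative ::
    "'a arrow_structure \<Rightarrow> 'b arrow_structure \<Rightarrow> ('a \<Rightarrow> 'b) \<Rightarrow> bool" where
  "monotone_implicative A B F \<longleftrightarrow> implicative_morphism A B F \<and>
     (\<forall>x\<in>carrier A. \<forall>y\<in>carrier A. x \<sqsubseteq>\<^bsub>A\<^esub> y \<longrightarrow> F x \<sqsubseteq>\<^bsub>B\<^esub> F y)"

definition pair_map :: "'a arrow_structure \<Rightarrow> ('a \<Rightarrow> 'b) \<Rightarrow> 'a \<times> 'a \<Rightarrow> 'b \<times> 'b" where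
  "pair_map A F = (\<lambda>x\<in>carrier (sierpinski A). (F (fst x), F (snd x)))"

lemma sierpinski_map_eq_pair_map: "sierpinski_map A B f = pair_map A (monotone_hull A B f)"
  by (auto simp: sierpinski_map_def pair_map_def monotone_hull_def carrier_sierpinski fun_eq_iff restrict_def)

lemma pair_map_identity: "pair_map A (identity_morphism A) = identity_morphism (sierpinski A)"
  by (auto simp: pair_map_def identity_morphism_def carrier_sierpinski fun_eq_iff restrict_def)

lemma monotone_implicativeD:
  assumes "monotone_implicative A B F"
  shows "implicative_morphism A B F" "F \<in> carrier A \<rightarrow> carrier B"
    and "x \<in> carrier A \<Longrightarrow> F x \<in> carrier B"
    and "\<lbrakk>x \<in> carrier A; y \<in> carrier A; x \<sqsubseteq>\<^bsub>A\<^esub> y\<rbrakk> \<Longrightarrow> F x \<sqsubseteq>\<^bsub>B\<^esub> F y"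
  using assms by (auto simp: monotone_implicative_def implicative_morphism_def PiE_def Pi_iff)

lemma pair_map_closed:
  assumes "monotone_implicative A B F" "x \<in> carrier (sierpinski A)"
  shows "pair_map A F x \<in> carrier (sierpinski B)"
  using assms by (simp add: pair_map_def carrier_sierpinski monotone_implicativeD[OF assms(1)])

lemma pair_map_compose:
  assumes "monotone_implicative A B F"
  shows "compose (carrier (sierpinski A)) (pair_map B G) (pair_map A F)
    = pair_map A (compose (carrier A) G F)"
  using pair_map_closed[OF assms]
  by (auto simp: fun_eq_iff compose_def pair_map_def restrict_def carrier_sierpinski)

lemma monotone_implicative_identity:
  "arrow_algebra A \<Longrightarrow> monotone_implicative A A (identity_morphism A)"
  by (simp add: monotone_implicative_def implicative_identity) (simp add: identity_morphism_def)

lemma monotone_implicative_compose: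
  assumes "arrow_algebra A" "arrow_algebra B" "arrow_algebra C"
    and F: "monotone_implicative A B F" and G: "monotone_implicative B C G"
  shows "monotone_implicative A C (compose (carrier A) G F)"
  using implicative_compose[OF assms(1-3) monotone_implicativeD(1)[OF F] monotone_implicativeD(1)[OF G]]
    monotone_implicativeD(3,4)[OF F] monotone_implicativeD(4)[OF G]
  by (simp add: monotone_implicative_def compose_eq)

text \<open>A realizer \<open>s\<close> of the first components gives the realizer \<open>(s, s)\<close>, because the second
  components lie above the first ones.\<close>

lemma (in arrow_algebra) realized_sierpinski_iff:
  assumes "\<And>i. i \<in> I \<Longrightarrow> \<phi> i \<in> carrier (sierpinski A)"
  shows "realized (sierpinski A) I \<phi> \<longleftrightarrow> realized A I (\<lambda>i. fst (\<phi> i))"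
proof
  assume "realized (sierpinski A) I \<phi>"
  then show "realized A I (\<lambda>i. fst (\<phi> i))"
    by (auto simp: realized_def separator_sierpinski le_sierpinski)
next
  assume "realized A I (\<lambda>i. fst (\<phi> i))"
  then obtain s where s: "s \<in> separator A" "\<And>i. i \<in> I \<Longrightarrow> s \<sqsubseteq> fst (\<phi> i)"
    unfolding realized_def by blast
  have sc: "s \<in> carrier A" using s(1) by (rule separator_carrier)
  have "s \<sqsubseteq> snd (\<phi> i)" if "i \<in> I" for i
    using le_trans[OF s(2)[OF that], of "snd (\<phi> i)"] assms[OF that] sc by simp
  then have "(s, s) \<in> separator (sierpinski A)" "\<forall>i\<in>I. (s, s) \<sqsubseteq>\<^bsub>sierpinski A\<^esub> \<phi> i"
    using s sc by (simp_all add: separator_sierpinski le_sierpinski carrier_sierpinski[of "(s, s)"])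
  then show "realized (sierpinski A) I \<phi>"
    unfolding realized_def by blast
qed

lemma (in arrow_algebra) realized_imp_sierpinski_iff:
  assumes c: "\<And>i. i \<in> I \<Longrightarrow> \<phi> i \<in> carrier (sierpinski A)" "\<And>i. i \<in> I \<Longrightarrow> \<psi> i \<in> carrier (sierpinski A)"
  shows "realized (sierpinski A) I (\<lambda>i. \<phi> i \<leadsto>\<^bsub>sierpinski A\<^esub> \<psi> i) \<longleftrightarrow>
    (\<exists>s\<in>separator A. \<forall>i\<in>I. s \<sqsubseteq> fst (\<phi> i) \<leadsto> fst (\<psi> i) \<and> s \<sqsubseteq> snd (\<phi> i) \<leadsto> snd (\<psi> i))"
  using c by (subst realized_sierpinski_iff)
    (simp_all add: imp_sierpinski_closed realized_def le_imp_sierpinski_iff separator_carrier cong: bex_cong)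

text \<open>The realizer for \<open>F\<close> serves both components: monotonicity gives
  \<open>F (fst (x \<leadsto> y)) \<sqsubseteq> F (fst x \<leadsto> fst y)\<close>, and likewise for \<open>snd\<close>. A uniformly realized
  set of implications \<open>X\<close> in the Sierpinski algebra is the set of its component implications in
  \<open>A\<close>, to which uniformity of \<open>F\<close> applies.\<close>

lemma implicative_pair_map:
  assumes A: "bi_arrow_algebra A" and B: "bi_arrow_algebra B" and F: "monotone_implicative A B F"
  shows "implicative_morphism (sierpinski A) (sierpinski B) (pair_map A F)"
proof -
  interpret A: bi_arrow_algebra A by fact
  interpret B: bi_arrow_algebra B by fact
  interpret F: implicative A B F
    by (intro implicative.intro implicative_axioms.intro A.arrow_algebra_axioms B.arrow_algebra_axioms
        monotone_implicativeD(1)[OF F])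
  let ?SA = "sierpinski A" and ?SB = "sierpinski B" and ?P = "pair_map A F"
  note [simp] = A.imp_sierpinski_closed B.imp_sierpinski_closed pair_map_closed[OF F]
  have P: "fst (?P x) = F (fst x)" "snd (?P x) = F (snd x)" if "x \<in> carrier ?SA" for x
    using that by (simp_all add: pair_map_def)
  show ?thesis
  proof (rule implicative_morphismI[OF A.arrow_algebra_sierpinski B.arrow_algebra_sierpinski])
    show "?P \<in> carrier ?SA \<rightarrow>\<^sub>E carrier ?SB"
      by (rule PiE_I) (simp, simp add: pair_map_def)
    show "?P x \<in> separator ?SB" if "x \<in> separator ?SA" for x
      using that by (simp add: separator_sierpinski P F.preserves_separator)
    have "realized B (carrier A \<times> carrier A)
        (\<lambda>p. F (fst p \<leadsto>\<^bsub>A\<^esub> snd p) \<leadsto>\<^bsub>B\<^esub> F (fst p) \<leadsto>\<^bsub>B\<^esub> F (snd p))"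
      by (rule F.realized_app) auto
    then obtain r where r: "r \<in> separator B"
      "\<And>a a'. \<lbrakk>a \<in> carrier A; a' \<in> carrier A\<rbrakk> \<Longrightarrow> r \<sqsubseteq>\<^bsub>B\<^esub> F (a \<leadsto>\<^bsub>A\<^esub> a') \<leadsto>\<^bsub>B\<^esub> F a \<leadsto>\<^bsub>B\<^esub> F a'"
      unfolding realized_def by fastforce
    have rc [simp]: "r \<in> carrier B" using r(1) by (rule B.separator_carrier)
    have "r \<sqsubseteq>\<^bsub>B\<^esub> fst (?P (x \<leadsto>\<^bsub>?SA\<^esub> y) \<leadsto>\<^bsub>?SB\<^esub> ?P x \<leadsto>\<^bsub>?SB\<^esub> ?P y)"
      if xy [simp]: "x \<in> carrier ?SA" "y \<in> carrier ?SA" for x y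
    proof -
      have weak: "r \<sqsubseteq>\<^bsub>B\<^esub> F (fst (x \<leadsto>\<^bsub>?SA\<^esub> y)) \<leadsto>\<^bsub>B\<^esub> F a \<leadsto>\<^bsub>B\<^esub> F a'"
        if a: "a \<in> carrier A" "a' \<in> carrier A" "fst (x \<leadsto>\<^bsub>?SA\<^esub> y) \<sqsubseteq>\<^bsub>A\<^esub> a \<leadsto>\<^bsub>A\<^esub> a'" for a a'
      proof (rule B.le_trans[OF r(2)[OF a(1,2)]])
        show "F (a \<leadsto>\<^bsub>A\<^esub> a') \<leadsto>\<^bsub>B\<^esub> F a \<leadsto>\<^bsub>B\<^esub> F a' \<sqsubseteq>\<^bsub>B\<^esub> F (fst (x \<leadsto>\<^bsub>?SA\<^esub> y)) \<leadsto>\<^bsub>B\<^esub> F a \<leadsto>\<^bsub>B\<^esub> F a'"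
          using a by (intro B.imp_antitone monotone_implicativeD(4)[OF F]) auto
      qed (use a in auto)
      note imp_fst = weak[OF _ _ A.imp_sierpinski_le(1)[OF xy]]
        and imp_snd = weak[OF _ _ A.imp_sierpinski_le(2)[OF xy]]
      show ?thesis
        using imp_fst imp_snd r(2)[of "snd x" "snd y"]
        by (simp add: B.le_imp_sierpinski_iff B.le_imp_imp_sierpinski_iff B.snd_imp_sierpinski
            A.snd_imp_sierpinski P)
    qed
    then have "realized B (carrier ?SA \<times> carrier ?SA)
        (\<lambda>p. fst (?P (fst p \<leadsto>\<^bsub>?SA\<^esub> snd p) \<leadsto>\<^bsub>?SB\<^esub> ?P (fst p) \<leadsto>\<^bsub>?SB\<^esub> ?P (snd p)))"
      unfolding realized_def by (intro bexI[OF _ r(1)] ballI) (simp add: mem_Times_iff)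
    then show "realized ?SB (carrier ?SA \<times> carrier ?SA)
        (\<lambda>p. ?P (fst p \<leadsto>\<^bsub>?SA\<^esub> snd p) \<leadsto>\<^bsub>?SB\<^esub> ?P (fst p) \<leadsto>\<^bsub>?SB\<^esub> ?P (snd p))"
      by (subst B.realized_sierpinski_iff) (simp_all add: mem_Times_iff)
    show "realized ?SB X (\<lambda>p. ?P (fst p) \<leadsto>\<^bsub>?SB\<^esub> ?P (snd p))"
      if X: "X \<subseteq> carrier ?SA \<times> carrier ?SA" and hyp: "realized ?SA X (\<lambda>p. fst p \<leadsto>\<^bsub>?SA\<^esub> snd p)" for X
    proof -
      have Xc [simp]: "fst p \<in> carrier ?SA" "snd p \<in> carrier ?SA" if "p \<in> X" for p
        using that X by auto
      obtain s where s: "s \<in> separator A"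
        "\<forall>p\<in>X. s \<sqsubseteq>\<^bsub>A\<^esub> fst (fst p) \<leadsto>\<^bsub>A\<^esub> fst (snd p) \<and> s \<sqsubseteq>\<^bsub>A\<^esub> snd (fst p) \<leadsto>\<^bsub>A\<^esub> snd (snd p)"
        using A.realized_imp_sierpinski_iff[of X fst snd, OF Xc, THEN iffD1, OF _ _ hyp] by blast
      \<comment> \<open>One index set for both components, so that \<open>F\<close> yields a single realizer for them.\<close>
      let ?Z = "(\<lambda>p. (fst (fst p), fst (snd p))) ` X \<union> (\<lambda>p. (snd (fst p), snd (snd p))) ` X"
      have Z: "fst q \<in> carrier A \<and> snd q \<in> carrier A" if "q \<in> ?Z" for q
        using that by (elim UnE imageE) simp_all
      have "realized A ?Z (\<lambda>q. fst q \<leadsto>\<^bsub>A\<^esub> snd q)"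
        unfolding realized_def using s by (intro bexI[of _ s]) (simp_all add: ball_Un)
      then have "realized B ?Z (\<lambda>q. F (fst q) \<leadsto>\<^bsub>B\<^esub> F (snd q))"
        by (rule F.realized_map) (use Z in blast)+
      then obtain t where "t \<in> separator B" "\<forall>q\<in>?Z. t \<sqsubseteq>\<^bsub>B\<^esub> F (fst q) \<leadsto>\<^bsub>B\<^esub> F (snd q)"
        unfolding realized_def by blast
      then show ?thesis
        by (subst B.realized_imp_sierpinski_iff) (simp_all add: P ball_Un bexI[of _ t])
    qed
  qed
qed

lemma morphism_le_pair_map:
  assumes B: "bi_arrow_algebra B"
    and F: "monotone_implicative A B F" and G: "monotone_implicative A B G"
    and le: "morphism_le A B F G"
  shows "morphism_le (sierpinski A) (sierpinski B) (pair_map A F) (pair_map A G)"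
proof -
  interpret B: bi_arrow_algebra B by fact
  have P: "pair_map A F \<in> carrier (sierpinski A) \<rightarrow> carrier (sierpinski B)"
    "pair_map A G \<in> carrier (sierpinski A) \<rightarrow> carrier (sierpinski B)"
    by (intro funcsetI pair_map_closed[OF F] pair_map_closed[OF G], assumption)+
  have "realized B (carrier A) (\<lambda>a. F a \<leadsto>\<^bsub>B\<^esub> G a)"
    using le unfolding morphism_le_iff_realized[OF B.arrow_algebra_axioms
        monotone_implicativeD(2)[OF F] monotone_implicativeD(2)[OF G]] .
  then obtain s where s: "s \<in> separator B" "\<forall>a\<in>carrier A. s \<sqsubseteq>\<^bsub>B\<^esub> F a \<leadsto>\<^bsub>B\<^esub> G a"
    unfolding realized_def by blast
  have "\<exists>s\<in>separator B. \<forall>x\<in>carrier (sierpinski A).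
      s \<sqsubseteq>\<^bsub>B\<^esub> fst (pair_map A F x) \<leadsto>\<^bsub>B\<^esub> fst (pair_map A G x) \<and>
      s \<sqsubseteq>\<^bsub>B\<^esub> snd (pair_map A F x) \<leadsto>\<^bsub>B\<^esub> snd (pair_map A G x)"
  proof (intro bexI[OF _ s(1)] ballI)
    fix x assume x: "x \<in> carrier (sierpinski A)"
    then have "fst x \<in> carrier A" "snd x \<in> carrier A" unfolding carrier_sierpinski by simp_all
    then show "s \<sqsubseteq>\<^bsub>B\<^esub> fst (pair_map A F x) \<leadsto>\<^bsub>B\<^esub> fst (pair_map A G x) \<and>
      s \<sqsubseteq>\<^bsub>B\<^esub> snd (pair_map A F x) \<leadsto>\<^bsub>B\<^esub> snd (pair_map A G x)"
      using x s(2) by (simp add: pair_map_def)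
  qed
  then show ?thesis
    unfolding morphism_le_iff_realized[OF B.arrow_algebra_sierpinski P]
    by (subst B.realized_imp_sierpinski_iff) 
      (assumption | erule pair_map_closed[OF F] | erule pair_map_closed[OF G])+
qed

lemma morphism_iso_pair_map:
  assumes "bi_arrow_algebra B" "monotone_implicative A B F" "monotone_implicative A B G"
    and "morphism_iso A B F G"
  shows "morphism_iso (sierpinski A) (sierpinski B) (pair_map A F) (pair_map A G)"
  using assms(4) unfolding morphism_iso_def by (blast intro: morphism_le_pair_map assms(1-3))

lemma monotone_hull_props:
  assumes A: "arrow_algebra A" and B: "arrow_algebra B" and f: "implicative_morphism A B f"
  shows "monotone_implicative A B (monotone_hull A B f)"
    and "morphism_le A B f (monotone_hull A B f)" "morphism_le A B (monotone_hull A B f) f"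
    and "f \<in> carrier A \<rightarrow> carrier B"
proof -
  interpret f: implicative A B f by (intro implicative.intro implicative_axioms.intro A B f)
  show "monotone_implicative A B (monotone_hull A B f)"
    using f.implicative_hull f.hull_mono by (simp add: monotone_implicative_def)
  show "morphism_le A B f (monotone_hull A B f)" "morphism_le A B (monotone_hull A B f) f"
    using f.hull_iso by (simp_all add: morphism_iso_def)
  show "f \<in> carrier A \<rightarrow> carrier B" by (rule f.funcset)
qed

lemma implicative_sierpinski_map:
  assumes "binary_implicative A" "binary_implicative B" "implicative_morphism A B f"
  shows "implicative_morphism (sierpinski A) (sierpinski B) (sierpinski_map A B f)"
  unfolding sierpinski_map_eq_pair_map using assms
  by (intro implicative_pair_map monotone_hull_props(1))
    (simp_all add: binary_implicative_def flip: binary_implicative_iff)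

lemma morphism_le_sierpinski_map:
  assumes A: "binary_implicative A" and B: "binary_implicative B"
    and f: "implicative_morphism A B f" and f': "implicative_morphism A B f'"
    and le: "morphism_le A B f f'"
  shows "morphism_le (sierpinski A) (sierpinski B) (sierpinski_map A B f) (sierpinski_map A B f')"
proof -
  have aA: "arrow_algebra A" and aB: "arrow_algebra B"
    using A B by (simp_all add: binary_implicative_def)
  note hull = monotone_hull_props[OF aA aB f] and hull' = monotone_hull_props[OF aA aB f']
  note trans = morphism_le_trans[OF aB]
  note F = monotone_implicativeD(2)[OF hull(1)] and F' = monotone_implicativeD(2)[OF hull'(1)]
  have "morphism_le A B (monotone_hull A B f) f'"
    by (rule trans[OF F hull(4) hull'(4) hull(3) le])
  then have "morphism_le A B (monotone_hull A B f) (monotone_hull A B f')"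
    by (rule trans[OF F hull'(4) F' _ hull'(2)])
  then show ?thesis
    unfolding sierpinski_map_eq_pair_map
    using B hull(1) hull'(1) by (intro morphism_le_pair_map) (auto simp: binary_implicative_iff)
qed

lemma monotone_hull_identity:
  assumes "arrow_algebra A"
  shows "morphism_iso A A (monotone_hull A A (identity_morphism A)) (identity_morphism A)"
  using monotone_hull_props[OF assms assms implicative_identity[OF assms]] by (simp add: morphism_iso_def)

text \<open>Passing to hulls in both factors changes the composite only up to isomorphism. The second
  direction uses that the hull of \<open>g\<close> is itself implicative, so that it can be applied to the
  realized implications from the hull of \<open>f\<close> to \<open>f\<close>.\<close>

lemma monotone_hull_compose:
  assumes A: "arrow_algebra A" and B: "arrow_algebra B" and C: "arrow_algebra C"
    and f: "implicative_morphism A B f" and g: "implicative_morphism B C g"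
  shows "morphism_iso A C (compose (carrier A) g f)
    (compose (carrier A) (monotone_hull B C g) (monotone_hull A B f))"
proof -
  note F = monotone_hull_props[OF A B f] and G = monotone_hull_props[OF B C g]
  note Fc = monotone_implicativeD(2)[OF F(1)] and Gc = monotone_implicativeD(2)[OF G(1)]
  show ?thesis
    unfolding morphism_iso_def
    using morphism_le_compose[OF B C F(4) Fc g Gc F(2) G(2)]
      morphism_le_compose[OF B C Fc F(4) monotone_implicativeD(1)[OF G(1)] G(4) F(3) G(3)] by simp
qed

lemma morphism_iso_sierpinski_map_identity:
  assumes "binary_implicative A"
  shows "morphism_iso (sierpinski A) (sierpinski A)
    (sierpinski_map A A (identity_morphism A)) (identity_morphism (sierpinski A))"
proof -
  have A: "arrow_algebra A" "bi_arrow_algebra A"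
    using assms by (simp_all add: binary_implicative_def flip: binary_implicative_iff)
  show ?thesis
    unfolding sierpinski_map_eq_pair_map pair_map_identity[symmetric]
    by (intro morphism_iso_pair_map A(2) monotone_hull_props(1) monotone_implicative_identity
        implicative_identity monotone_hull_identity A(1))
qed

lemma morphism_iso_sierpinski_map_compose:
  assumes A: "binary_implicative A" and B: "binary_implicative B" and C: "binary_implicative C"
    and f: "implicative_morphism A B f" and g: "implicative_morphism B C g"
  shows "morphism_iso (sierpinski A) (sierpinski C)
    (sierpinski_map A C (compose (carrier A) g f))
    (compose (carrier (sierpinski A)) (sierpinski_map B C g) (sierpinski_map A B f))"
proof -
  have aA: "arrow_algebra A" and aB: "arrow_algebra B" and aC: "arrow_algebra C"
    using A B C by (simp_all add: binary_implicative_def)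
  let ?F = "monotone_hull A B f" and ?G = "monotone_hull B C g"
  let ?gf = "compose (carrier A) g f" and ?GF = "compose (carrier A) ?G ?F"
  have gf: "implicative_morphism A C ?gf" by (rule implicative_compose[OF aA aB aC f g])
  note H = monotone_hull_props[OF aA aC gf]
  note F = monotone_hull_props(1)[OF aA aB f]
  have GF: "monotone_implicative A C ?GF"
    by (rule monotone_implicative_compose[OF aA aB aC F monotone_hull_props(1)[OF aB aC g]])
  note Hc = monotone_implicativeD(2)[OF H(1)] and GFc = monotone_implicativeD(2)[OF GF]
  have 1: "morphism_le A C ?gf ?GF" "morphism_le A C ?GF ?gf"
    using monotone_hull_compose[OF aA aB aC f g] by (simp_all add: morphism_iso_def)
  have "morphism_iso A C (monotone_hull A C ?gf) ?GF"
    unfolding morphism_iso_def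
    using morphism_le_trans[OF aC Hc H(4) GFc H(3) 1(1)] morphism_le_trans[OF aC GFc H(4) Hc 1(2) H(2)]
    by simp
  then have "morphism_iso (sierpinski A) (sierpinski C) (pair_map A (monotone_hull A C ?gf)) (pair_map A ?GF)"
    using C H(1) GF by (intro morphism_iso_pair_map) (simp_all add: binary_implicative_iff)
  then show ?thesis
    by (simp add: sierpinski_map_eq_pair_map pair_map_compose[OF F])
qed

text \<open>Both inequalities of the adjunction are inequalities between composites. Passing to hulls
  keeps them, and the resulting composites of pair maps are pair maps of composites.\<close>

lemma right_adjoint_sierpinski_map:
  assumes A: "binary_implicative A" and B: "binary_implicative B"
    and f: "implicative_morphism A B f" and adj: "right_adjoint A B f h"
  shows "right_adjoint (sierpinski A) (sierpinski B) (sierpinski_map A B f) (sierpinski_map B A h)"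
proof -
  have aA: "arrow_algebra A" and aB: "arrow_algebra B"
    using A B by (simp_all add: binary_implicative_def)
  have h: "implicative_morphism B A h"
    and counit: "morphism_le B B (compose (carrier B) f h) (identity_morphism B)"
    and unit: "morphism_le A A (identity_morphism A) (compose (carrier A) h f)"
    using adj by (simp_all add: right_adjoint_def)
  let ?F = "monotone_hull A B f" and ?H = "monotone_hull B A h"
  note F = monotone_hull_props(1)[OF aA aB f] and H = monotone_hull_props(1)[OF aB aA h]
  note FH = monotone_implicative_compose[OF aB aA aB H F] and HF = monotone_implicative_compose[OF aA aB aA F H]
  note idA = monotone_implicative_identity[OF aA] and idB = monotone_implicative_identity[OF aB]
  note fh = implicative_compose[OF aB aA aB h f] and hf = implicative_compose[OF aA aB aA f h]
  have "morphism_le B B (compose (carrier B) ?F ?H) (compose (carrier B) f h)"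
    "morphism_le A A (compose (carrier A) h f) (compose (carrier A) ?H ?F)"
    using monotone_hull_compose[OF aB aA aB h f] monotone_hull_compose[OF aA aB aA f h]
    by (simp_all add: morphism_iso_def)
  then have "morphism_le B B (compose (carrier B) ?F ?H) (identity_morphism B)"
    "morphism_le A A (identity_morphism A) (compose (carrier A) ?H ?F)"
    using morphism_le_trans[OF aB monotone_implicativeD(2)[OF FH] monotone_hull_props(4)[OF aB aB fh]
        monotone_implicativeD(2)[OF idB] _ counit]
      morphism_le_trans[OF aA monotone_implicativeD(2)[OF idA] monotone_hull_props(4)[OF aA aA hf]
        monotone_implicativeD(2)[OF HF] unit]
    by simp_all
  then show ?thesis
    unfolding right_adjoint_def sierpinski_map_eq_pair_map pair_map_compose[OF F] pair_map_compose[OF H]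
      pair_map_identity[symmetric]
    using A B F H FH HF idA idB
    by (intro conjI implicative_pair_map morphism_le_pair_map) (simp_all add: binary_implicative_iff)
qed

lemma pseudofunctor_sierpinski:
  "pseudofunctor
     (ArrAlg_bi :: ('a arrow_structure, 'a \<Rightarrow> 'a) enriched_structure)
     (ArrAlg_bi :: (('a \<times> 'a) arrow_structure, 'a \<times> 'a \<Rightarrow> 'a \<times> 'a) enriched_structure)
     sierpinski sierpinski_map"
proof (intro pseudofunctor.intro pseudofunctor_axioms.intro preorder_enriched_category_ArrAlg_bi)
qed (use bi_arrow_algebra.bi_arrow_algebra_sierpinski in
    \<open>auto simp: ArrAlg_bi_def Iso2_def implicative_sierpinski_map morphism_le_sierpinski_map
      binary_implicative_iff[symmetric]
      morphism_iso_sierpinski_map_identity[unfolded morphism_iso_def]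
      morphism_iso_sierpinski_map_compose[unfolded morphism_iso_def]\<close>)

theorem proposition8p6:
  shows
    "pseudofunctor
       (ArrAlg_bi :: ('u arrow_structure, 'u \<Rightarrow> 'u) enriched_structure)
       (ArrAlg_bi :: (('u \<times> 'u) arrow_structure, 'u \<times> 'u \<Rightarrow> 'u \<times> 'u) enriched_structure)
       sierpinski sierpinski_map \<and>
     (\<forall>(A :: 'a arrow_structure) (B :: 'b arrow_structure) f.
        binary_implicative A \<and> binary_implicative B \<and> implicative_morphism A B f \<longrightarrow>
        implicative_morphism (sierpinski A) (sierpinski B) (sierpinski_map A B f)) \<and>
     (\<forall>(A :: 'a arrow_structure) (B :: 'b arrow_structure) f f'.
        binary_implicative A \<and> binary_implicative B \<and>
        implicative_morphism A B f \<and> implicative_morphism A B f' \<and> morphism_le A B f f' \<longrightarrow>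
        morphism_le (sierpinski A) (sierpinski B) (sierpinski_map A B f) (sierpinski_map A B f')) \<and>
     (\<forall>(A :: 'a arrow_structure) (B :: 'b arrow_structure) (C :: 'c arrow_structure) f g.
        binary_implicative A \<and> binary_implicative B \<and> binary_implicative C \<and>
        implicative_morphism A B f \<and> implicative_morphism B C g \<longrightarrow>
        morphism_iso (sierpinski A) (sierpinski C)
          (sierpinski_map A C (compose (carrier A) g f))
          (compose (carrier (sierpinski A)) (sierpinski_map B C g) (sierpinski_map A B f))) \<and>
     (\<forall>(A :: 'a arrow_structure) (B :: 'b arrow_structure) f h.
        binary_implicative A \<and> binary_implicative B \<and>
        implicative_morphism A B f \<and> right_adjoint A B f h \<longrightarrow>
        computationally_dense (sierpinski A) (sierpinski B) (sierpinski_map A B f) \<and>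
        right_adjoint (sierpinski A) (sierpinski B) (sierpinski_map A B f) (sierpinski_map B A h))"
  using pseudofunctor_sierpinski implicative_sierpinski_map morphism_le_sierpinski_map
    morphism_iso_sierpinski_map_compose right_adjoint_sierpinski_map
  unfolding computationally_dense_def by blast

end
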